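(* Let $N\ge2$ and $\alpha>0$ be fixed. For $\beta>0$ let $(\lambda_1,\dots,\lambda_N)$ be distributed according to the beta Laguerre ensemble, with joint density proportional to $$\prod_{i<j}|\lambda_j-\lambda_i|^\beta\prod_{i=1}^N\Big(\lambda_i^{\frac\beta2\alpha-1}e^{-\frac\beta2\lambda_i}\Big),\qquad 0<\lambda_1<\cdots<\lambda_N,$$ and let $L_N=\frac1N\sum_{i=1}^N\delta_{\lambda_i}$. Let $\mu=\frac1N\sum_{i=1}^N\delta_{z_{i,N}^{(\alpha)}}$ and $\mu^*=\frac{1}{N(\alpha+N-1)}\sum_{i=1}^Nz_{i,N}^{(\alpha)}\delta_{z_{i,N}^{(\alpha)}}$, where $z_{1,N}^{(\alpha)}<\dots<z_{N,N}^{(\alpha)}$ are the zeros of the $N$th Laguerre polynomial $L_N^{(\alpha)}$. Let $\{q_n\}_{n=0}^{N-1}$ be the dual Laguerre polynomials (the monic polynomials orthogonal with respect to the probability measure $\mu^*$) and let $Q_n$ be a primitive of $q_n$. Then, as $\beta\to\infty$, $$\sqrt{\beta N/2}\,\big(\langle L_N,Q_n\rangle-\langle\mu,Q_n\rangle\big)_{n=0}^{N-1}\ \longrightarrow\ \mathcal N_N\left(0,\operatorname{diag}\left(\frac{\alpha+N-1}{n+1}\,\langle q_n,q_n\rangle_{\mu^*}\right)_{n=0}^{N-1}\right)$$ in distribution.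
   Context: $\{L_n^{(\alpha)}\}_{n\ge0}$ are the monic polynomials orthogonal with respect to the weight $x^{\alpha-1}e^{-x}$ on $(0,\infty)$. The dual polynomials are given explicitly by $q_0=1$, $q_1=x-(\alpha+2(N-1))$, and $q_{n+1}=\big(x-(\alpha+2(N-n-1))\big)q_n-(N-n)(\alpha+N-n-1)q_{n-1}$ for $n=1,\dots,N-2$. $\langle\nu,f\rangle=\int f\,d\nu$, $\langle f,g\rangle_{\mu^*}=\int fg\,d\mu^*$, and $\mathcal N_N(0,\Sigma)$ is the $N$-dimensional centered Gaussian law with covariance $\Sigma$. *)

theory Defs
  imports "HOL-Probability.Probability"
begin

text \<open>
  Vectors \<open>(x\<^sub>1, \<dots>, x\<^sub>N)\<close> are elements of \<open>real ^ 'n\<close> for a finite linearly ordered index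
  type \<open>'n\<close> with \<open>N = CARD('n)\<close>. The order of \<open>'n\<close> is the order of the indices, and \<open>index0\<close> is
  the unique order isomorphism from \<open>'n\<close> to \<open>{0, \<dots>, N - 1}\<close>; it is used where a component has to
  be matched with the degree of a polynomial.
\<close>

definition index0 :: "'n::{finite,linorder} \<Rightarrow> nat" where
  "index0 i = card {j. j < i}"

definition strictly_increasing :: "real ^ 'n::{finite,linorder} \<Rightarrow> bool" where
  "strictly_increasing x \<longleftrightarrow> (\<forall>i j. i < j \<longrightarrow> x $ i < x $ j)"

text \<open>
  The family \<open>p n\<close>, \<open>n \<in> I\<close>, consists of the monic orthogonal polynomials of \<open>M\<close>. The integrability
  clause excludes the convention that a non-integrable function has integral \<open>0\<close>.
\<close>

definition monic_orthogonal_polys :: "real measure \<Rightarrow> nat set \<Rightarrow> (nat \<Rightarrow> real poly) \<Rightarrow> bool" where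
  "monic_orthogonal_polys M I p \<longleftrightarrow>
     (\<forall>n\<in>I. degree (p n) = n \<and> lead_coeff (p n) = 1) \<and>
     (\<forall>m\<in>I. \<forall>n\<in>I. integrable M (\<lambda>x. poly (p m) x * poly (p n) x)) \<and>
     (\<forall>m\<in>I. \<forall>n\<in>I. m \<noteq> n \<longrightarrow> (LINT x|M. poly (p m) x * poly (p n) x) = 0)"

text \<open>The exponent is \<open>\<alpha> - 1\<close>, not the \<open>\<alpha>\<close> of the classical convention.\<close>

definition laguerre_measure :: "real \<Rightarrow> real measure" where
  "laguerre_measure \<alpha> =
     density lborel (\<lambda>x. ennreal (if 0 < x then x powr (\<alpha> - 1) * exp (- x) else 0))"

text \<open>The measure \<open>\<Sum>i. w i \<cdot> \<delta>(x $ i)\<close>; coinciding points add up their weights.\<close>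

definition atomic_measure :: "('n::finite \<Rightarrow> real) \<Rightarrow> real ^ 'n \<Rightarrow> real measure" where
  "atomic_measure w x = distr (point_measure UNIV (\<lambda>i. ennreal (w i))) borel (\<lambda>i. x $ i)"

definition empirical_measure :: "real ^ 'n::finite \<Rightarrow> real measure" where
  "empirical_measure x = atomic_measure (\<lambda>_. 1 / real CARD('n)) x"

definition dual_measure :: "real \<Rightarrow> real ^ 'n::finite \<Rightarrow> real measure" where
  "dual_measure \<alpha> z =
     atomic_measure (\<lambda>i. z $ i / (real CARD('n) * (\<alpha> + real CARD('n) - 1))) z"

definition beta_laguerre_weight :: "real \<Rightarrow> real \<Rightarrow> real ^ 'n::{finite,linorder} \<Rightarrow> real" where
  "beta_laguerre_weight \<beta> \<alpha> x =
     (if (\<forall>i. 0 < x $ i) \<and> strictly_increasing x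
      then (\<Prod>(i, j)\<in>{(i, j). i < j}. \<bar>x $ j - x $ i\<bar> powr \<beta>) *
           (\<Prod>i\<in>UNIV. x $ i powr (\<beta> / 2 * \<alpha> - 1) * exp (- (\<beta> / 2) * x $ i))
      else 0)"

definition beta_laguerre_ensemble ::
  "real \<Rightarrow> real \<Rightarrow> 'a measure \<Rightarrow> ('a \<Rightarrow> real ^ 'n::{finite,linorder}) \<Rightarrow> bool" where
  "beta_laguerre_ensemble \<beta> \<alpha> M X \<longleftrightarrow>
     prob_space M \<and>
     (\<exists>c>0. distributed M lborel X (\<lambda>x. ennreal (c * beta_laguerre_weight \<beta> \<alpha> x)))"

text \<open>
  The library's weak convergence covers sequences of measures on the real line only. As usual, the
  definition is meant for probability measures on the Borel sigma-algebra.
\<close>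

definition weakly_converges ::
  "('b \<Rightarrow> 'a::topological_space measure) \<Rightarrow> 'a measure \<Rightarrow> 'b filter \<Rightarrow> bool" where
  "weakly_converges P P' F \<longleftrightarrow>
     (\<forall>f :: 'a \<Rightarrow> real. continuous_on UNIV f \<longrightarrow> bounded (range f) \<longrightarrow>
        ((\<lambda>b. LINT x|P b. f x) \<longlongrightarrow> (LINT x|P'. f x)) F)"

text \<open>
  The centered Gaussian law with covariance \<open>\<Sigma>\<close>, by its characteristic function (which determines
  the law uniquely).
\<close>

definition centered_gaussian :: "real ^ 'n ^ 'n \<Rightarrow> (real ^ 'n::finite) measure \<Rightarrow> bool" where
  "centered_gaussian \<Sigma> G \<longleftrightarrow>
     prob_space G \<and> sets G = sets borel \<and>
     (\<forall>t. (CLINT x|G. iexp (t \<bullet> x)) = complex_of_real (exp (- (t \<bullet> (\<Sigma> *v t)) / 2)))"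

end

theory Submission
  imports Defs "HOL-Real_Asymp.Real_Asymp"
begin

text \<open>
  The Laguerre equation at the zeros \<open>z\<close> of \<open>L\<^sub>N\<close> says that \<open>z\<close> is a critical point of the energy
  \<open>\<Sum>i. x\<^sub>i - \<alpha> * ln x\<^sub>i - 2 * \<Sum>i<j. ln (x\<^sub>j - x\<^sub>i)\<close>. The energy excess over \<open>z\<close> is therefore a positive
  combination of the terms \<open>s - 1 - ln s\<close> with \<open>s = x\<^sub>i / z\<^sub>i\<close> and \<open>s = (x\<^sub>j - x\<^sub>i) / (z\<^sub>j - z\<^sub>i)\<close>, and after
  the rescaling \<open>x = z + sqrt (2 / \<beta>) u\<close> dominated convergence gives a Gaussian limit with inverse
  covariance the Hessian \<open>H\<close> of the energy at \<open>z\<close>. Writing \<open>D\<close> for the diagonal matrix of \<open>z\<close>, the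
  matrix \<open>H D\<close> sends the values at \<open>z\<close> of a polynomial of degree \<open>n\<close> to those of \<open>n + 1\<close> times the
  polynomial plus terms of lower degree. It is self-adjoint for the inner product of the dual measure,
  so the dual polynomials are its eigenvectors, with eigenvalues \<open>n + 1\<close>, and the linearised statistics
  are independent.
\<close>

section \<open>Zeros of Laguerre polynomials\<close>

text \<open>The weight carries the exponent \<open>b / 2 * a - 1\<close>, so \<open>z\<close> is
  critical for the energy but not for the density itself. Relative to \<open>z\<close>, the -1
  leaves a factor 1 / s per particle, which is unbounded near s = 0 and must be absorbed into the
  exponential before dominated convergence applies. The one-particle factors alone supply an
  integrable majorant; each pair factor is at most 1. Normalising constants disappear because
  expectations are quotients of two integrals over the same kernel, whose limits share a constant.
  The variance has three sources. Let s_n be the sum of z_i q_n(z_i)^2. The direction D q_n has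
  squared length (n + 1) s_n for the form H, the linearised statistic takes the value s_n / sqrt N
  on it, and the dual measure gives s_n = N (\<alpha> + N - 1) <q_n, q_n>. The variance is therefore
  s_n / (N (n + 1)) = (\<alpha> + N - 1) / (n + 1) <q_n, q_n>.\<close>

lemma has_bochner_integral_laguerre_measure_power:
  assumes "a > 0"
  shows "has_bochner_integral (laguerre_measure a) (\<lambda>x. x ^ k) (Gamma (a + real k))"
proof -
  define g :: "real \<Rightarrow> real" where "g = (\<lambda>x. if 0 < x then x powr (a - 1) * exp (- x) else 0)"
  define h :: "real \<Rightarrow> real" where "h = (\<lambda>x. if 0 < x then x powr (a + real k - 1) * exp (- x) else 0)"
  have [measurable]: "g \<in> borel_measurable borel" "h \<in> borel_measurable borel"
    unfolding g_def h_def by measurable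
  have pos: "a + real k > 0"
    using assms by simp
  have "((\<lambda>t. t powr (a + real k - 1) / exp t) has_integral Gamma (a + real k)) {0..}"
    by (rule Gamma_integral_real[OF pos])
  hence "((\<lambda>t. if t \<in> {0..} then t powr (a + real k - 1) / exp t else 0) has_integral Gamma (a + real k)) UNIV"
    by (subst has_integral_restrict_UNIV)
  hence "(h has_integral Gamma (a + real k)) UNIV"
    by (rule has_integral_spike[of "{0}", rotated 2]) (auto simp: h_def exp_minus field_simps)
  hence "integral\<^sup>N lborel h = Gamma (a + real k)"
    by (intro nn_integral_has_integral_lborel) (auto simp: h_def)
  hence "has_bochner_integral lborel h (Gamma (a + real k))"
    using pos by (intro has_bochner_integral_nn_integral) (auto simp: h_def Gamma_real_pos less_imp_le)
  moreover have "h = (\<lambda>x. g x *\<^sub>R x ^ k)"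
  proof
    fix x
    have "x powr (a + real k - 1) = x powr (a - 1) * x ^ k" if "x > 0"
      using that by (simp add: powr_add[symmetric] powr_realpow[symmetric] algebra_simps)
    thus "h x = g x *\<^sub>R x ^ k"
      by (auto simp: h_def g_def)
  qed
  ultimately have "has_bochner_integral lborel (\<lambda>x. g x *\<^sub>R x ^ k) (Gamma (a + real k))"
    by simp
  hence "has_bochner_integral (density lborel (\<lambda>x. ennreal (g x))) (\<lambda>x. x ^ k) (Gamma (a + real k))"
    by (intro has_bochner_integral_density) (auto simp: g_def)
  thus ?thesis
    by (simp add: laguerre_measure_def g_def)
qed

lemma integrable_laguerre_measure_poly:
  assumes "a > 0"
  shows "integrable (laguerre_measure a) (poly p)"
proof -
  have "integrable (laguerre_measure a) (\<lambda>x. \<Sum>i\<le>degree p. coeff p i * x ^ i)"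
    using has_bochner_integral_laguerre_measure_power[OF assms]
    by (intro Bochner_Integration.integrable_sum integrable_mult_right)
       (auto simp: has_bochner_integral_iff)
  thus ?thesis
    by (simp add: poly_altdef[abs_def])
qed

text \<open>
  Integration by parts against \<open>x powr a * exp (- x)\<close>; it is read off the recurrence
  \<open>Gamma (s + 1) = s * Gamma s\<close> of the moments.
\<close>

lemma integral_laguerre_measure_pderiv:
  assumes "a > 0"
  shows "(LINT x|laguerre_measure a. poly ([:0, 1:] * pderiv p + [:a, -1:] * p) x) = 0"
proof -
  define F where "F p = (LINT x|laguerre_measure a. poly ([:0, 1:] * pderiv p + [:a, -1:] * p) x)" for p
  note [simp] = integrable_laguerre_measure_poly[OF assms]
  have add: "F (p + q) = F p + F q" for p q
  proof -
    have "F (p + q) = (LINT x|laguerre_measure a.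
      poly ([:0, 1:] * pderiv p + [:a, -1:] * p) x + poly ([:0, 1:] * pderiv q + [:a, -1:] * q) x)"
      unfolding F_def by (rule Bochner_Integration.integral_cong) (simp_all add: pderiv_add algebra_simps)
    also have "\<dots> = F p + F q"
      unfolding F_def by (rule Bochner_Integration.integral_add; rule integrable_laguerre_measure_poly[OF assms])
    finally show ?thesis .
  qed
  have mon: "F (monom c n) = 0" for c n
  proof -
    have eq: "poly ([:0, 1:] * pderiv (monom c n) + [:a, -1:] * monom c n) x
      = c * (a + real n) * x ^ n - c * x ^ Suc n" for x
      by (cases n) (simp_all add: pderiv_monom poly_monom algebra_simps)
    have "has_bochner_integral (laguerre_measure a) (\<lambda>x. c * (a + real n) * x ^ n - c * x ^ Suc n)
      (c * (a + real n) * Gamma (a + real n) - c * Gamma (a + real (Suc n)))"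
      by (intro has_bochner_integral_diff has_bochner_integral_mult_right
          has_bochner_integral_laguerre_measure_power assms)
    moreover have "Gamma (a + real (Suc n)) = (a + real n) * Gamma (a + real n)"
      using Gamma_plus1[of "a + real n"] assms nonpos_Ints_nonpos[of "a + real n"]
      by (force simp: add_ac)
    ultimately show ?thesis
      unfolding F_def eq by (simp add: has_bochner_integral_iff)
  qed
  have "F (\<Sum>i\<in>A. monom (coeff p i) i) = 0" if "finite A" for A
    using that by induction (auto simp: add mon, simp add: F_def)
  from this[of "{..degree p}"] show ?thesis
    by (simp add: poly_as_sum_of_monoms F_def)
qed

text \<open>A nonzero polynomial has only finitely many zeros, so a vanishing integral would turn
  the interval from 0 to 1 into a null set.\<close>

lemma integral_laguerre_measure_poly_pos:
  assumes "a > 0" "p \<noteq> 0" and nonneg: "\<And>x. x > 0 \<Longrightarrow> poly p x \<ge> 0"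
  shows "(LINT x|laguerre_measure a. poly p x) > 0"
proof (rule ccontr)
  have ae_pos: "AE x in laguerre_measure a. x > 0"
    unfolding laguerre_measure_def by (subst AE_density) (auto split: if_splits)
  hence ae_nonneg: "AE x in laguerre_measure a. poly p x \<ge> 0"
    by eventually_elim (rule nonneg)
  assume "\<not> ?thesis"
  moreover have "(LINT x|laguerre_measure a. poly p x) \<ge> 0"
    by (rule integral_nonneg_AE[OF ae_nonneg])
  ultimately have "(LINT x|laguerre_measure a. poly p x) = 0"
    by linarith
  hence "AE x in laguerre_measure a. poly p x = 0"
    by (subst (asm) integral_nonneg_eq_0_iff_AE)
       (auto intro: integrable_laguerre_measure_poly[OF assms(1)] ae_nonneg)
  hence ae: "AE x in lborel. 0 < x \<longrightarrow> poly p x = 0"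
    unfolding laguerre_measure_def by (subst (asm) AE_density) auto
  have "finite {x. poly p x = 0}"
    using assms(2) by (rule poly_roots_finite)
  hence "AE x in lborel. x \<notin> {x. poly p x = 0}"
    by (intro AE_not_in finite_imp_null_set_lborel)
  with ae have "AE x in lborel. x \<notin> {0<..<1::real}"
    by eventually_elim auto
  hence "emeasure lborel {0<..<1::real} = 0"
    by (subst (asm) AE_iff_measurable[of "{0<..<1}"]) auto
  thus False
    by simp
qed

text \<open>Induction on a bound \<open>k\<close> for \<open>r\<close>, with \<open>n\<close> fixed:
  subtracting \<open>coeff r k\<close> times \<open>p k\<close> lowers the bound. The hypothesis
  speaks of coefficients instead of the degree so that the bound 0 can mean
  \<open>r = 0\<close>.\<close>

lemma monic_orthogonal_polys_lower_degree:
  assumes "monic_orthogonal_polys M I p" "n \<in> I" "{..<n} \<subseteq> I" "\<And>i. i \<ge> n \<Longrightarrow> coeff r i = 0"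
  shows "integrable M (\<lambda>x. poly (p n) x * poly r x) \<and> (LINT x|M. poly (p n) x * poly r x) = 0"
proof -
  have "k \<le> n \<Longrightarrow> (\<And>i. i \<ge> k \<Longrightarrow> coeff r i = 0) \<Longrightarrow>
    integrable M (\<lambda>x. poly (p n) x * poly r x) \<and> (LINT x|M. poly (p n) x * poly r x) = 0" for k
  proof (induction k arbitrary: r)
    case 0
    hence "r = 0"
      by (simp add: poly_eq_iff coeff_eq_0 poly_eqI)
    thus ?case by simp
  next
    case (Suc k)
    define r' where "r' = r - smult (coeff r k) (p k)"
    have k: "k \<in> I" "k \<noteq> n"
      using Suc.prems(1) assms(3) by auto
    have mon: "degree (p k) = k" "coeff (p k) k = 1"
      using assms(1) k(1) unfolding monic_orthogonal_polys_def by metis+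
    have "coeff r' i = 0" if "i \<ge> k" for i
    proof (cases "i = k")
      case False
      thus ?thesis
        using that Suc.prems(2)[of i] mon by (simp add: r'_def coeff_eq_0)
    qed (simp add: r'_def mon)
    from Suc.IH[OF _ this] Suc.prems(1)
    have IH: "integrable M (\<lambda>x. poly (p n) x * poly r' x)" "(LINT x|M. poly (p n) x * poly r' x) = 0"
      by auto
    have orth: "integrable M (\<lambda>x. poly (p n) x * poly (p k) x)" "(LINT x|M. poly (p n) x * poly (p k) x) = 0"
      using assms(1,2) k unfolding monic_orthogonal_polys_def by auto
    have "poly (p n) x * poly r x = poly (p n) x * poly r' x + coeff r k * (poly (p n) x * poly (p k) x)" for x
      by (simp add: r'_def algebra_simps)
    thus ?case
      using IH orth by simp
  qed
  from this[of n] assms(4) show ?thesis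
    by auto
qed

text \<open>The operator of Laguerre's differential equation; the classical a + 1 becomes a because
  the weight has exponent a - 1.\<close>

definition laguerre_op :: "real \<Rightarrow> real poly \<Rightarrow> real poly" where
  "laguerre_op a p = [:0, 1:] * pderiv (pderiv p) + [:a, -1:] * pderiv p"

text \<open>In the monomial basis the operator is triangular with diagonal entries -i, so degrees do
  not grow and -n is the eigenvalue for degree n.\<close>

lemma coeff_laguerre_op:
  "coeff (laguerre_op a p) i = real (Suc i) * (a + real i) * coeff p (Suc i) - real i * coeff p i"
  by (cases i) (simp_all add: laguerre_op_def coeff_pderiv algebra_simps)

text \<open>Integration by parts turns either side into minus the integral of x p' r', which is
  symmetric in \<open>p\<close> and \<open>r\<close>.\<close>

lemma laguerre_op_symmetric:
  assumes "a > 0"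
  shows "(LINT x|laguerre_measure a. poly (laguerre_op a p * r) x) =
    (LINT x|laguerre_measure a. poly (p * laguerre_op a r) x)"
proof -
  note [simp] = integrable_laguerre_measure_poly[OF assms]
  have "(LINT x|laguerre_measure a. poly (laguerre_op a p * r) x) =
    - (LINT x|laguerre_measure a. poly ([:0, 1:] * (pderiv p * pderiv r)) x)" for p r
  proof -
    have "[:0, 1:] * pderiv (pderiv p * r) + [:a, -1:] * (pderiv p * r)
      = laguerre_op a p * r + [:0, 1:] * (pderiv p * pderiv r)"
      by (simp only: laguerre_op_def pderiv_mult algebra_simps)
    hence "0 = (LINT x|laguerre_measure a. poly (laguerre_op a p * r) x + poly ([:0, 1:] * (pderiv p * pderiv r)) x)"
      using integral_laguerre_measure_pderiv[OF assms, of "pderiv p * r"] by (simp only: poly_add)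
    thus ?thesis
      by (subst (asm) Bochner_Integration.integral_add) (simp_all del: poly_mult mult_pCons_left)
  qed
  from this[of p r] this[of r p] show ?thesis
    by (simp only: mult.commute)
qed

text \<open>By triangularity the residue \<open>R\<close> has degree below \<open>n\<close>, and so
  has its image under the operator. Symmetry moves the operator from \<open>L n\<close> to
  \<open>R\<close>, so both parts of the integral of R^2 vanish by orthogonality, and positivity
  forces R = 0.\<close>

lemma laguerre_op_monic_orthogonal:
  assumes "a > 0" and L: "monic_orthogonal_polys (laguerre_measure a) UNIV L"
  shows "laguerre_op a (L n) + smult (real n) (L n) = 0"
proof (rule ccontr)
  define R where "R = laguerre_op a (L n) + smult (real n) (L n)"
  assume "\<not> ?thesis"
  hence "R \<noteq> 0"
    by (simp add: R_def)
  note [simp] = integrable_laguerre_measure_poly[OF assms(1)]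
  have deg: "degree (L n) = n"
    using L unfolding monic_orthogonal_polys_def by auto
  have R: "coeff R i = 0" if "i \<ge> n" for i
    using that coeff_eq_0[of "L n" i] coeff_eq_0[of "L n" "Suc i"] deg
    by (cases "i = n") (simp_all add: R_def coeff_laguerre_op)
  have "coeff (laguerre_op a R) i = 0" if "i \<ge> n" for i
    using that by (simp add: coeff_laguerre_op R)
  hence "(LINT x|laguerre_measure a. poly (L n) x * poly (laguerre_op a R) x) = 0"
    using monic_orthogonal_polys_lower_degree[OF L] by blast
  hence "(LINT x|laguerre_measure a. poly (L n * laguerre_op a R) x) = 0"
    by (simp only: poly_mult)
  hence 1: "(LINT x|laguerre_measure a. poly (laguerre_op a (L n) * R) x) = 0"
    by (simp only: laguerre_op_symmetric[OF assms(1)])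
  have "(LINT x|laguerre_measure a. poly (L n) x * poly R x) = 0"
    using monic_orthogonal_polys_lower_degree[OF L] R by blast
  hence 2: "(LINT x|laguerre_measure a. poly (smult (real n) (L n) * R) x) = 0"
    by (simp add: mult.assoc)
  have "(LINT x|laguerre_measure a. poly (R * R) x) =
    (LINT x|laguerre_measure a. poly (laguerre_op a (L n) * R) x + poly (smult (real n) (L n) * R) x)"
    by (rule Bochner_Integration.integral_cong) (simp_all add: R_def algebra_simps)
  also have "\<dots> = 0"
    by (subst Bochner_Integration.integral_add) (use 1 2 in \<open>simp_all del: poly_mult mult_smult_left\<close>)
  finally show False
    using integral_laguerre_measure_poly_pos[OF assms(1), of "R * R"] \<open>R \<noteq> 0\<close> by simp
qed

section \<open>Positivity of the zeros and their equilibrium equations\<close>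

lemma strictly_increasing_inj:
  assumes "strictly_increasing z"
  shows "inj (\<lambda>i. z $ i)"
  using assms unfolding strictly_increasing_def inj_def by (metis less_irrefl linorder_neqE)

text \<open>With the zero split off, L_n(y) = (y - x) P(y), orthogonality to \<open>P\<close> reads:
  x times the integral of P^2 equals the integral of y P^2. Both integrals are positive.\<close>

lemma laguerre_zero_pos:
  assumes "a > 0" and L: "monic_orthogonal_polys (laguerre_measure a) UNIV L" and "poly (L n) x = 0"
  shows "x > 0"
proof -
  note [simp] = integrable_laguerre_measure_poly[OF assms(1)]
  have deg: "degree (L n) = n" "lead_coeff (L n) = 1"
    using L unfolding monic_orthogonal_polys_def by blast+
  obtain P where P: "L n = [:-x, 1:] * P"
    using assms(3) by (metis dvdE poly_eq_0_iff_dvd)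
  have "L n \<noteq> 0"
    using deg(2) by auto
  hence P0: "P \<noteq> 0"
    using P by auto
  have "degree (L n) = Suc (degree P)"
    unfolding P using P0 by (subst degree_mult_eq) auto
  hence "coeff P i = 0" if "i \<ge> n" for i
    using that deg(1) by (intro coeff_eq_0) auto
  hence "(LINT y|laguerre_measure a. poly (L n) y * poly P y) = 0"
    using monic_orthogonal_polys_lower_degree[OF L] by blast
  also have "(\<lambda>y. poly (L n) y * poly P y) = (\<lambda>y. poly ([:0,1:] * (P * P)) y - x * poly (P * P) y)"
    by (auto simp: P fun_eq_iff algebra_simps)
  also have "(LINT y|laguerre_measure a. poly ([:0,1:] * (P * P)) y - x * poly (P * P) y) =
    (LINT y|laguerre_measure a. poly ([:0,1:] * (P * P)) y) - x * (LINT y|laguerre_measure a. poly (P * P) y)"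
    by (subst Bochner_Integration.integral_diff) (simp_all del: poly_mult mult_pCons_left)
  finally have "x * (LINT y|laguerre_measure a. poly (P * P) y) = (LINT y|laguerre_measure a. poly ([:0,1:] * (P * P)) y)"
    by simp
  moreover have "(LINT y|laguerre_measure a. poly (P * P) y) > 0"
    "(LINT y|laguerre_measure a. poly ([:0,1:] * (P * P)) y) > 0"
    using P0 by (intro integral_laguerre_measure_poly_pos[OF assms(1)]; simp)+
  ultimately show ?thesis
    by (metis zero_less_mult_pos2)
qed

lemma poly_eq_prod_roots:
  fixes z :: "'n::finite \<Rightarrow> real"
  assumes "inj z" "degree p = CARD('n)" "lead_coeff p = 1" "\<And>i. poly p (z i) = 0"
  shows "p = (\<Prod>i\<in>UNIV. [:- z i, 1:])"
proof (rule poly_eqI_degree_lead_coeff[where A = "range z" and n = "CARD('n)"])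
  have deg: "degree (\<Prod>i\<in>UNIV. [:- z i, 1:]) = CARD('n)"
    by (subst degree_prod_eq_sum_degree) auto
  have "lead_coeff (\<Prod>i\<in>UNIV. [:- z i, 1:]) = 1"
    by (simp add: lead_coeff_prod)
  thus "coeff p CARD('n) = coeff (\<Prod>i\<in>UNIV. [:- z i, 1:]) CARD('n)"
    using assms(2,3) deg by simp
  show "degree (\<Prod>i\<in>UNIV. [:- z i, 1:]) \<le> CARD('n)"
    using deg by simp
  show "CARD('n) \<le> card (range z)"
    using assms(1) by (simp add: card_image)
  show "poly p x = poly (\<Prod>i\<in>UNIV. [:- z i, 1:]) x" if "x \<in> range z" for x
    using that assms(4) by (auto simp: poly_prod intro: exI)
qed (use assms(2) in simp)

text \<open>Stieltjes' electrostatic equations. With p = (x - z_i) P the Laguerre equation at z_i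
  involves only p'(z_i) = P(z_i) and p''(z_i) = 2 P'(z_i), and P' / P at z_i is the sum of the 1 /
  (z_i - z_j).\<close>

lemma laguerre_zeros_critical:
  fixes z :: "'n::finite \<Rightarrow> real"
  assumes "a > 0" and L: "monic_orthogonal_polys (laguerre_measure a) UNIV L"
    and z: "inj z" "\<And>i. poly (L CARD('n)) (z i) = 0"
  shows "1 = a / z i + 2 * (\<Sum>j\<in>UNIV - {i}. 1 / (z i - z j))"
proof -
  define p where "p = L CARD('n)"
  define P where "P = (\<Prod>j\<in>UNIV - {i}. [:- z j, 1:])"
  have "p = (\<Prod>i\<in>UNIV. [:- z i, 1:])"
    using L z unfolding p_def monic_orthogonal_polys_def by (intro poly_eq_prod_roots) blast+
  hence p: "p = [:- z i, 1:] * P"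
    unfolding P_def by (subst (asm) prod.remove[of _ i]) auto
  have 1: "poly (pderiv p) (z i) = poly P (z i)"
    by (simp add: p pderiv_mult pderiv_pCons del: mult_pCons_left)
  have 2: "poly (pderiv (pderiv p)) (z i) = 2 * poly (pderiv P) (z i)"
    by (simp add: p pderiv_mult pderiv_pCons pderiv_add pderiv_smult del: mult_pCons_left)
  have ne: "z i - z j \<noteq> 0" if "j \<noteq> i" for j
    using z(1) that by (auto dest: injD)
  have P0: "poly P (z i) \<noteq> 0"
    using ne by (auto simp: P_def poly_prod)
  have "poly (pderiv P) (z i) = (\<Sum>j\<in>UNIV - {i}. poly (prod (\<lambda>j. [:- z j, 1:]) (UNIV - {i} - {j})) (z i))"
    by (simp add: P_def pderiv_prod poly_sum pderiv_pCons)
  also have "\<dots> = (\<Sum>j\<in>UNIV - {i}. poly P (z i) * (1 / (z i - z j)))"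
  proof (rule sum.cong)
    fix j assume j: "j \<in> UNIV - {i}"
    have "P = [:- z j, 1:] * prod (\<lambda>j. [:- z j, 1:]) (UNIV - {i} - {j})"
      unfolding P_def using j by (subst prod.remove[of _ j]) auto
    thus "poly (prod (\<lambda>j. [:- z j, 1:]) (UNIV - {i} - {j})) (z i) = poly P (z i) * (1 / (z i - z j))"
      using ne[of j] j by (simp add: field_simps del: mult_pCons_left)
  qed simp
  finally have 3: "poly (pderiv P) (z i) = poly P (z i) * (\<Sum>j\<in>UNIV - {i}. 1 / (z i - z j))"
    by (simp only: sum_distrib_left)
  have "poly (laguerre_op a p + smult (real CARD('n)) p) (z i) = 0"
    using laguerre_op_monic_orthogonal[OF assms(1) L] by (simp add: p_def)
  hence "z i * (2 * poly (pderiv P) (z i)) + (a - z i) * poly P (z i) = 0"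
    using z(2)[of i] by (simp add: laguerre_op_def 1 2 p_def[symmetric] algebra_simps)
  hence "poly P (z i) * (2 * z i * (\<Sum>j\<in>UNIV - {i}. 1 / (z i - z j)) + a - z i) = 0"
    unfolding 3 by (simp add: algebra_simps)
  hence "2 * z i * (\<Sum>j\<in>UNIV - {i}. 1 / (z i - z j)) + a - z i = 0"
    using P0 by simp
  moreover have "z i > 0"
    using laguerre_zero_pos[OF assms(1) L z(2)] .
  ultimately show ?thesis
    by (simp add: field_simps)
qed

section \<open>The Hessian of the energy and the dual polynomials\<close>

text \<open>
  Double sums over \<open>i\<close> and \<open>j\<close> with denominator \<open>z i - z j\<close> include the diagonal: its terms are \<open>0\<close>
  because \<open>x / 0 = 0\<close>.
\<close>

definition log_gas_form :: "real \<Rightarrow> ('n::finite \<Rightarrow> real) \<Rightarrow> ('n \<Rightarrow> real) \<Rightarrow> ('n \<Rightarrow> real) \<Rightarrow> real" where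
  "log_gas_form a z u v = a * (\<Sum>i\<in>UNIV. u i * v i / (z i)\<^sup>2) +
     (\<Sum>i\<in>UNIV. \<Sum>j\<in>UNIV. (u i - u j) * (v i - v j) / (z i - z j)\<^sup>2)"

text \<open>The Hessian of the energy applied to \<open>v\<close>. The factor 2 arises because the
  double sum in \<open>log_gas_form\<close> meets each index in both positions.\<close>

definition log_gas_hess :: "real \<Rightarrow> ('n::finite \<Rightarrow> real) \<Rightarrow> ('n \<Rightarrow> real) \<Rightarrow> 'n \<Rightarrow> real" where
  "log_gas_hess a z v i = a * v i / (z i)\<^sup>2 + 2 * (\<Sum>j\<in>UNIV. (v i - v j) / (z i - z j)\<^sup>2)"

text \<open>Exchanging the two indices maps the \<open>u j\<close> half to the \<open>u i\<close>
  half. Used for the Hessian and again for the equilibrium equations.\<close>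

lemma sum_antisymmetric:
  fixes G :: "'n::finite \<Rightarrow> 'n \<Rightarrow> real"
  assumes "\<And>i j. G j i = - G i j"
  shows "(\<Sum>i\<in>UNIV. \<Sum>j\<in>UNIV. (u i - u j) * G i j) = 2 * (\<Sum>i\<in>UNIV. u i * (\<Sum>j\<in>UNIV. G i j))"
proof -
  have "(\<Sum>i\<in>UNIV. \<Sum>j\<in>UNIV. u j * G i j) = (\<Sum>j\<in>UNIV. \<Sum>i\<in>UNIV. u j * G i j)"
    by (rule sum.swap)
  also have "\<dots> = (\<Sum>j\<in>UNIV. \<Sum>i\<in>UNIV. - (u j * G j i))"
    using assms by (intro sum.cong refl) (metis mult_minus_right)
  finally have "(\<Sum>i\<in>UNIV. \<Sum>j\<in>UNIV. u j * G i j) = - (\<Sum>i\<in>UNIV. \<Sum>j\<in>UNIV. u i * G i j)"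
    by (simp only: sum_negf)
  thus ?thesis
    by (simp add: left_diff_distrib sum_subtractf sum_distrib_left)
qed

lemma log_gas_form_hess: "log_gas_form a z u v = (\<Sum>i\<in>UNIV. u i * log_gas_hess a z v i)"
proof -
  have "(\<Sum>i\<in>UNIV. \<Sum>j\<in>UNIV. (u i - u j) * ((v i - v j) / (z i - z j)\<^sup>2)) =
    2 * (\<Sum>i\<in>UNIV. u i * (\<Sum>j\<in>UNIV. (v i - v j) / (z i - z j)\<^sup>2))"
    by (rule sum_antisymmetric) (simp add: power2_commute minus_divide_left)
  thus ?thesis
    by (simp add: log_gas_form_def log_gas_hess_def distrib_left sum.distrib sum_distrib_left mult_ac)
qed

lemma log_gas_form_commute: "log_gas_form a z u v = log_gas_form a z v u"
  by (simp add: log_gas_form_def mult.commute)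

text \<open>This is the second-order Taylor remainder at \<open>x\<close> of the power n + 1,
  evaluated at \<open>y\<close>; pulling out (x - y)^2 leaves a homogeneous polynomial of degree n -
  1 (zero for n = 0). It separates the singular part of the Hessian sums from a polynomial
  part.\<close>

lemma power_remainder:
  fixes x y :: real
  shows "real (Suc n) * x ^ n * (x - y) - (x ^ Suc n - y ^ Suc n) =
    (x - y)\<^sup>2 * (\<Sum>l<n. real (n - l) * x ^ (n - 1 - l) * y ^ l)"
proof (induction n)
  case (Suc n)
  define R where "R n = (\<Sum>l<n. real (n - l) * x ^ (n - 1 - l) * y ^ l)" for n
  define S where "S = (\<Sum>l<Suc n. x ^ (n - l) * y ^ l)"
  have S: "(x - y) * S = x ^ Suc n - y ^ Suc n"
    using diff_power_eq_sum[of y n x] by (simp add: S_def algebra_simps)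
  \<comment> \<open>The induction rests on R_(n+1) = x R_n + S, where \<open>S\<close> is the
    quotient of x^(n+1) - y^(n+1) by x - y.\<close>
  have "R (Suc n) = (\<Sum>l<Suc n. real (n - l) * x ^ (n - l) * y ^ l + x ^ (n - l) * y ^ l)"
    unfolding R_def by (rule sum.cong) (auto simp: Suc_diff_le algebra_simps)
  also have "\<dots> = (\<Sum>l<n. real (n - l) * x ^ (n - l) * y ^ l) + S"
    by (simp add: sum.distrib S_def)
  also have "(\<Sum>l<n. real (n - l) * x ^ (n - l) * y ^ l) = x * R n"
    unfolding R_def sum_distrib_left
  proof (rule sum.cong)
    fix l assume "l \<in> {..<n}"
    hence "n - l = Suc (n - 1 - l)"
      by auto
    hence "x ^ (n - l) = x * x ^ (n - 1 - l)"
      by (metis power_Suc)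
    thus "real (n - l) * x ^ (n - l) * y ^ l = x * (real (n - l) * x ^ (n - 1 - l) * y ^ l)"
      by simp
  qed simp
  finally have "(x - y)\<^sup>2 * R (Suc n) = x * ((x - y)\<^sup>2 * R n) + (x - y) * ((x - y) * S)"
    by (simp add: algebra_simps power2_eq_square)
  also have "(x - y)\<^sup>2 * R n = real (Suc n) * x ^ n * (x - y) - (x ^ Suc n - y ^ Suc n)"
    using Suc.IH by (simp add: R_def)
  finally show ?case
    unfolding S R_def by (simp add: algebra_simps)
qed simp

text \<open>The singular terms add up to (n + 1) z_i^n times twice the sum of the 1 / (z_i - z_j),
  which criticality turns into (n + 1) z_i^n (1 - a / z_i). Together with a z_i^(n-1) from the
  one-particle term, only (n + 1) z_i^n and terms of degree at most n - 1 remain.\<close>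

lemma log_gas_hess_monom:
  assumes z: "inj z" "\<And>i. z i \<noteq> 0"
    and crit: "\<And>i. 1 = a / z i + 2 * (\<Sum>j\<in>UNIV. 1 / (z i - z j))"
  obtains r where "\<And>k. k \<ge> n \<Longrightarrow> coeff r k = 0"
    "\<And>i. log_gas_hess a z (\<lambda>i. z i ^ Suc n) i = real (Suc n) * z i ^ n + poly r (z i)"
proof -
  define R where "R x y = (\<Sum>l<n. real (n - l) * x ^ (n - 1 - l) * y ^ l)" for x y :: real
  \<comment> \<open>The summand 2 (n - l) undoes the diagonal: at \<open>j = i\<close> the Hessian
    term is 0 by division by zero, whereas the sum over all \<open>j\<close> contains R(z_i,
    z_i).\<close>
  define r where "r = (\<Sum>l<n. monom (- a + 2 * real (n - l)) (n - 1) -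
    (\<Sum>j\<in>UNIV. monom (2 * real (n - l) * z j ^ l) (n - 1 - l)))"
  have "coeff r k = 0" if "k \<ge> n" for k
    unfolding r_def using that by (auto simp: coeff_sum intro!: sum.neutral)
  moreover have "log_gas_hess a z (\<lambda>i. z i ^ Suc n) i = real (Suc n) * z i ^ n + poly r (z i)" for i
  proof -
    have quotient: "(z i ^ Suc n - z j ^ Suc n) / (z i - z j)\<^sup>2 =
      real (Suc n) * z i ^ n * (1 / (z i - z j)) - R (z i) (z j) + (if j = i then R (z i) (z i) else 0)" for j
    proof (cases "j = i")
      case False
      hence "z i - z j \<noteq> 0"
        using z(1) by (auto dest: injD)
      moreover have "z i ^ Suc n - z j ^ Suc n = real (Suc n) * z i ^ n * (z i - z j) - (z i - z j)\<^sup>2 * R (z i) (z j)"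
        using power_remainder[of n "z i" "z j"] by (simp add: R_def)
      ultimately show ?thesis
        using False by (simp add: diff_divide_distrib power2_eq_square)
    qed simp
    have "(\<Sum>j\<in>UNIV. (z i ^ Suc n - z j ^ Suc n) / (z i - z j)\<^sup>2) =
      real (Suc n) * z i ^ n * (\<Sum>j\<in>UNIV. 1 / (z i - z j)) - (\<Sum>j\<in>UNIV. R (z i) (z j)) + R (z i) (z i)"
      unfolding quotient by (simp add: sum.distrib sum_subtractf sum_distrib_left)
    hence "log_gas_hess a z (\<lambda>i. z i ^ Suc n) i = a * z i ^ Suc n / (z i)\<^sup>2 +
      real (Suc n) * z i ^ n * (2 * (\<Sum>j\<in>UNIV. 1 / (z i - z j))) - 2 * (\<Sum>j\<in>UNIV. R (z i) (z j)) + 2 * R (z i) (z i)"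
      unfolding log_gas_hess_def by (simp add: algebra_simps)
    also have "2 * (\<Sum>j\<in>UNIV. 1 / (z i - z j)) = 1 - a / z i"
      using crit[of i] by simp
    also have "a * z i ^ Suc n / (z i)\<^sup>2 = a * (z i ^ n / z i)"
      using z(2)[of i] by (simp add: power2_eq_square)
    finally have 1: "log_gas_hess a z (\<lambda>i. z i ^ Suc n) i = real (Suc n) * z i ^ n -
      a * real n * (z i ^ n / z i) - 2 * (\<Sum>j\<in>UNIV. R (z i) (z j)) + 2 * R (z i) (z i)"
      by (simp add: algebra_simps)
    have 2: "real n * (z i ^ n / z i) = (\<Sum>l<n. z i ^ (n - 1))"
      using z(2)[of i] by (cases n) auto
    have 3: "R (z i) (z i) = (\<Sum>l<n. real (n - l) * z i ^ (n - 1))"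
      unfolding R_def by (rule sum.cong) (auto simp: mult.assoc simp flip: power_add)
    have "poly r (z i) = (\<Sum>l<n. (- a + 2 * real (n - l)) * z i ^ (n - 1) -
        (\<Sum>j\<in>UNIV. 2 * real (n - l) * z j ^ l * z i ^ (n - 1 - l)))"
      by (simp add: r_def poly_sum poly_monom)
    also have "\<dots> = - a * (\<Sum>l<n. z i ^ (n - 1)) + 2 * (\<Sum>l<n. real (n - l) * z i ^ (n - 1)) -
        2 * (\<Sum>l<n. \<Sum>j\<in>UNIV. real (n - l) * z i ^ (n - 1 - l) * z j ^ l)"
      by (simp add: sum_subtractf sum.distrib sum_distrib_left algebra_simps)
    also have "(\<Sum>l<n. \<Sum>j\<in>UNIV. real (n - l) * z i ^ (n - 1 - l) * z j ^ l) = (\<Sum>j\<in>UNIV. R (z i) (z j))"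
      unfolding R_def by (rule sum.swap)
    also have "- a * (\<Sum>l<n. z i ^ (n - 1)) = - a * real n * (z i ^ n / z i)"
      unfolding 2[symmetric] by simp
    finally show ?thesis
      unfolding 1 3 by simp
  qed
  ultimately show ?thesis
    using that by blast
qed

lemma log_gas_hess_lin:
  "log_gas_hess a z (\<lambda>i. c * u i + d * v i) i = c * log_gas_hess a z u i + d * log_gas_hess a z v i"
proof -
  have "(c * u i + d * v i - (c * u j + d * v j)) / (z i - z j)\<^sup>2 =
    c * ((u i - u j) / (z i - z j)\<^sup>2) + d * ((v i - v j) / (z i - z j)\<^sup>2)" for j
    by (simp add: add_divide_distrib[symmetric] algebra_simps)
  hence "(\<Sum>j\<in>UNIV. (c * u i + d * v i - (c * u j + d * v j)) / (z i - z j)\<^sup>2) =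
    c * (\<Sum>j\<in>UNIV. (u i - u j) / (z i - z j)\<^sup>2) + d * (\<Sum>j\<in>UNIV. (v i - v j) / (z i - z j)\<^sup>2)"
    by (simp only: sum.distrib sum_distrib_left)
  thus ?thesis
    unfolding log_gas_hess_def by (simp only:) (simp add: add_divide_distrib algebra_simps)
qed

text \<open>Peeling off the leading term reduces to monomials; the factor \<open>z i\<close> in
  front of the polynomial is the matrix D of the overview.\<close>

lemma log_gas_hess_poly:
  assumes z: "inj z" "\<And>i. z i \<noteq> 0"
    and crit: "\<And>i. 1 = a / z i + 2 * (\<Sum>j\<in>UNIV. 1 / (z i - z j))"
    and "\<And>k. k > n \<Longrightarrow> coeff p k = 0"
  shows "\<exists>r. (\<forall>k\<ge>n. coeff r k = 0) \<and>
    (\<forall>i. log_gas_hess a z (\<lambda>i. z i * poly p (z i)) i = real (Suc n) * poly p (z i) + poly r (z i))"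
  using assms(4)
proof (induction n arbitrary: p)
  case 0
  obtain r where r: "\<And>k. k \<ge> 0 \<Longrightarrow> coeff r k = 0"
    "\<And>i. log_gas_hess a z (\<lambda>i. z i ^ Suc 0) i = real (Suc 0) * z i ^ 0 + poly r (z i)"
    using log_gas_hess_monom[OF z crit] by metis
  have p: "p = [:coeff p 0:]"
    using 0 by (auto simp: poly_eq_iff coeff_pCons split: nat.splits)
  \<comment> \<open>The zero summand brings the function into the shape of
    \<open>log_gas_hess_lin\<close>.\<close>
  have "log_gas_hess a z (\<lambda>i. coeff p 0 * z i ^ Suc 0 + 0 * 0) i =
    coeff p 0 * (real (Suc 0) * z i ^ 0 + poly r (z i)) + 0 * log_gas_hess a z (\<lambda>i. 0) i" for i
    by (simp only: log_gas_hess_lin r(2))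
  moreover have "r = 0"
    using r(1) by (simp add: poly_eq_iff)
  ultimately show ?case
    by (subst (1 2) p) (auto simp: mult.commute intro!: exI[of _ 0])
next
  case (Suc n)
  obtain r where r: "\<And>k. k \<ge> Suc n \<Longrightarrow> coeff r k = 0"
    "\<And>i. log_gas_hess a z (\<lambda>i. z i ^ Suc (Suc n)) i = real (Suc (Suc n)) * z i ^ Suc n + poly r (z i)"
    using log_gas_hess_monom[OF z crit] by metis
  define c where "c = coeff p (Suc n)"
  define p' where "p' = p - monom c (Suc n)"
  have p': "coeff p' k = 0" if "k > n" for k
    using that Suc.prems[of k] by (cases "k = Suc n") (auto simp: p'_def c_def)
  from Suc.IH[OF this] obtain r' where r': "\<And>k. k \<ge> n \<Longrightarrow> coeff r' k = 0"
    "\<And>i. log_gas_hess a z (\<lambda>i. z i * poly p' (z i)) i = real (Suc n) * poly p' (z i) + poly r' (z i)"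
    by blast
  have p: "poly p x = c * x ^ Suc n + poly p' x" for x
    by (simp add: p'_def poly_monom)
  have "(\<lambda>i. z i * poly p (z i)) = (\<lambda>i. c * z i ^ Suc (Suc n) + 1 * (z i * poly p' (z i)))"
    by (simp add: p algebra_simps)
  hence "log_gas_hess a z (\<lambda>i. z i * poly p (z i)) i =
      c * (real (Suc (Suc n)) * z i ^ Suc n + poly r (z i)) + 1 * (real (Suc n) * poly p' (z i) + poly r' (z i))" for i
    by (simp only: log_gas_hess_lin r(2) r'(2))
  \<comment> \<open>The lower part \<open>p'\<close> has the factor \<open>Suc n\<close>, one less
    than the leading term, so one copy of \<open>p'\<close> goes to the remainder.\<close>
  hence "log_gas_hess a z (\<lambda>i. z i * poly p (z i)) i =
      real (Suc (Suc n)) * poly p (z i) + poly (smult c r + r' - p') (z i)" for i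
    by (simp add: p algebra_simps)
  moreover have "coeff (smult c r + r' - p') k = 0" if "k \<ge> Suc n" for k
    using that r(1)[of k] r'(1)[of k] p'[of k] by simp
  ultimately show ?case
    by blast
qed

text \<open>For n \<le> m the Hessian is applied to the function of lower degree; its remainder has
  degree below n \<le> m and is orthogonal to \<open>q m\<close>. Symmetry of the form covers n > m:
  a triangular symmetric form is diagonal.\<close>

lemma log_gas_form_orthogonal:
  assumes z: "inj z" "\<And>i. z i \<noteq> 0"
    and crit: "\<And>i. 1 = a / z i + 2 * (\<Sum>j\<in>UNIV. 1 / (z i - z j))"
    and deg: "\<And>n. n < N \<Longrightarrow> degree (q n) = n"
    and orth: "\<And>n r. n < N \<Longrightarrow> (\<And>k. k \<ge> n \<Longrightarrow> coeff r k = 0) \<Longrightarrow> (\<Sum>i\<in>UNIV. z i * poly (q n) (z i) * poly r (z i)) = 0"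
    and "m < N" "n < N"
  shows "log_gas_form a z (\<lambda>i. z i * poly (q m) (z i)) (\<lambda>i. z i * poly (q n) (z i)) =
    (if m = n then real (Suc n) * (\<Sum>i\<in>UNIV. z i * (poly (q n) (z i))\<^sup>2) else 0)"
proof -
  have *: "log_gas_form a z (\<lambda>i. z i * poly (q m) (z i)) (\<lambda>i. z i * poly (q n) (z i)) =
    (if m = n then real (Suc n) * (\<Sum>i\<in>UNIV. z i * (poly (q n) (z i))\<^sup>2) else 0)"
    if "n \<le> m" "m < N" for m n
  proof -
    have dn: "coeff (q n) k = 0" if "k > n" for k
      using that \<open>n \<le> m\<close> \<open>m < N\<close> deg[of n] by (intro coeff_eq_0) auto
    obtain r where r: "\<And>k. k \<ge> n \<Longrightarrow> coeff r k = 0"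
      "\<And>i. log_gas_hess a z (\<lambda>i. z i * poly (q n) (z i)) i = real (Suc n) * poly (q n) (z i) + poly r (z i)"
      using log_gas_hess_poly[OF z crit dn] by blast
    have "log_gas_form a z (\<lambda>i. z i * poly (q m) (z i)) (\<lambda>i. z i * poly (q n) (z i)) =
      real (Suc n) * (\<Sum>i\<in>UNIV. z i * poly (q m) (z i) * poly (q n) (z i)) +
      (\<Sum>i\<in>UNIV. z i * poly (q m) (z i) * poly r (z i))"
      by (simp add: log_gas_form_hess r(2) sum.distrib sum_distrib_left algebra_simps)
    also have "(\<Sum>i\<in>UNIV. z i * poly (q m) (z i) * poly r (z i)) = 0"
      using that r(1) by (intro orth) auto
    also have "(\<Sum>i\<in>UNIV. z i * poly (q m) (z i) * poly (q n) (z i)) = 0" if "m \<noteq> n"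
      using that \<open>n \<le> m\<close> \<open>m < N\<close> dn by (intro orth) auto
    hence "real (Suc n) * (\<Sum>i\<in>UNIV. z i * poly (q m) (z i) * poly (q n) (z i)) =
      (if m = n then real (Suc n) * (\<Sum>i\<in>UNIV. z i * (poly (q n) (z i))\<^sup>2) else 0)"
      by (simp add: power2_eq_square mult_ac)
    finally show ?thesis
      by simp
  qed
  show ?thesis
  proof (cases "n \<le> m")
    case True
    thus ?thesis
      using * assms by blast
  next
    case False
    thus ?thesis
      using *[of m n] assms by (subst log_gas_form_commute) auto
  qed
qed

lemma log_gas_form_sum_left:
  "log_gas_form a z (\<lambda>i. \<Sum>k\<in>A. x k * w k i) v = (\<Sum>k\<in>A. x k * log_gas_form a z (w k) v)"
  unfolding log_gas_form_hess sum_distrib_left sum_distrib_right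
  by (subst sum.swap) (simp only: mult.assoc)

lemma log_gas_form_sum:
  assumes "\<And>k l. log_gas_form a z (w k) (w l) = (if k = l then d k else 0)"
  shows "log_gas_form a z (\<lambda>i. \<Sum>k\<in>(UNIV :: 'k::finite set). x k * w k i) (\<lambda>i. \<Sum>k\<in>UNIV. x k * w k i) =
    (\<Sum>k\<in>UNIV. (x k)\<^sup>2 * d k)"
proof -
  have "log_gas_form a z (w k) (\<lambda>i. \<Sum>k\<in>UNIV. x k * w k i) = x k * d k" for k
    by (subst log_gas_form_commute) (simp add: log_gas_form_sum_left assms if_distrib cong: if_cong)
  thus ?thesis
    by (simp add: log_gas_form_sum_left power2_eq_square mult.assoc)
qed

section \<open>Lebesgue measure on \<open>real ^ 'n\<close>\<close>

lemma index0_less: "index0 (i :: 'n::{finite,linorder}) < CARD('n)"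
  unfolding index0_def by (rule psubset_card_mono) auto

lemma index0_strict_mono: "i < j \<Longrightarrow> index0 i < index0 (j :: 'n::{finite,linorder})"
  unfolding index0_def by (rule psubset_card_mono) auto

lemma inj_index0: "inj (index0 :: 'n::{finite,linorder} \<Rightarrow> nat)"
  by (metis index0_strict_mono injI less_irrefl linorder_neqE)

lemma atomic_measure_integral:
  fixes f :: "real \<Rightarrow> real"
  assumes [measurable]: "f \<in> borel_measurable borel" and "\<And>i. w i \<ge> 0"
  shows "(LINT x|atomic_measure w z. f x) = (\<Sum>i\<in>UNIV. w i * f (z $ i))"
proof -
  have "(\<lambda>i. z $ i) \<in> point_measure UNIV (\<lambda>i. ennreal (w i)) \<rightarrow>\<^sub>M borel"
    by (simp add: point_measure_def)
  thus ?thesis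
    using assms(2) unfolding atomic_measure_def
    by (subst integral_distr) (auto simp: lebesgue_integral_point_measure_finite)
qed

section \<open>Lebesgue measure in coordinates\<close>

lemma measurable_vec_lambda_PiM [measurable]:
  "(\<lambda>f. (\<chi> i. f i) :: real ^ 'n) \<in> borel_measurable (\<Pi>\<^sub>M i\<in>UNIV. borel)"
  by (subst borel_measurable_euclidean_space) (auto simp: Basis_vec_def inner_axis)

lemma measurable_vec_nth [measurable]: "(\<lambda>x :: real ^ 'n. x $ i) \<in> borel_measurable borel"
  by (intro borel_measurable_continuous_onI continuous_intros)

lemma prod_Basis_vec:
  fixes f :: "real ^ 'n \<Rightarrow> 'b::comm_monoid_mult"
  shows "(\<Prod>b\<in>Basis. f b) = (\<Prod>i\<in>UNIV. f (axis i 1))"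
proof -
  have Basis: "Basis = range (\<lambda>i::'n. axis i (1::real))"
    by (auto simp: Basis_vec_def)
  show ?thesis
    unfolding Basis by (subst prod.reindex) (auto simp: inj_on_def axis_eq_axis)
qed

lemma lborel_vec_eqI:
  fixes M :: "(real ^ 'n) measure"
  assumes "\<And>l u. (\<And>i. l $ i \<le> u $ i) \<Longrightarrow> emeasure M (box l u) = ennreal (\<Prod>i\<in>UNIV. u $ i - l $ i)"
    and "sets M = sets borel"
  shows "lborel = M"
proof (rule lborel_eqI)
  fix l u :: "real ^ 'n"
  assume "\<And>b. b \<in> Basis \<Longrightarrow> l \<bullet> b \<le> u \<bullet> b"
  hence "l $ i \<le> u $ i" for i
    by (metis axis_in_Basis_iff cart_eq_inner_axis one_neq_zero Basis_real_def insertI1)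
  thus "emeasure M (box l u) = ennreal (\<Prod>b\<in>Basis. (u - l) \<bullet> b)"
    using assms(1) by (simp add: prod_Basis_vec inner_axis)
qed (use assms in simp)

text \<open>Makes the Fubini theorems for finite product measures available for vectors.\<close>

lemma lborel_vec_eq: "(lborel :: (real ^ 'n) measure) = distr (\<Pi>\<^sub>M i\<in>UNIV. lborel) borel (\<lambda>f. \<chi> i. f i)"
proof (rule lborel_vec_eqI)
  interpret product_sigma_finite "\<lambda>_ :: 'n. lborel :: real measure"
    by standard
  fix l u :: "real ^ 'n"
  assume le: "\<And>i. l $ i \<le> u $ i"
  have "(\<lambda>f. \<chi> i. f i) -` box l u \<inter> space (\<Pi>\<^sub>M i\<in>(UNIV::'n set). (lborel :: real measure)) = (\<Pi>\<^sub>E i\<in>UNIV. {l $ i<..<u $ i})"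
    by (auto simp: mem_box_cart space_PiM PiE_def Pi_def)
  thus "emeasure (distr (\<Pi>\<^sub>M i\<in>UNIV. lborel) borel (\<lambda>f. \<chi> i. f i)) (box l u) = ennreal (\<Prod>i\<in>UNIV. u $ i - l $ i)"
    using le by (subst emeasure_distr) (auto simp: emeasure_PiM prod_ennreal cong: measurable_cong_sets)
qed simp

lemma lborel_vec_prod:
  fixes f :: "'n::finite \<Rightarrow> real \<Rightarrow> 'b::{real_normed_field,banach,second_countable_topology}"
  assumes "\<And>i. integrable lborel (f i)"
  shows "integrable lborel (\<lambda>x :: real ^ 'n. \<Prod>i\<in>UNIV. f i (x $ i))"
    and "(LINT x|(lborel :: (real ^ 'n) measure). (\<Prod>i\<in>UNIV. f i (x $ i))) = (\<Prod>i\<in>UNIV. (LINT x|lborel. f i x))"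
proof -
  interpret product_sigma_finite "\<lambda>_ :: 'n. lborel :: real measure"
    by standard
  have [measurable]: "f i \<in> borel_measurable borel" for i
    using borel_measurable_integrable[OF assms[of i]] by simp
  have [measurable]: "(\<lambda>f. \<chi> i. f i) \<in> (\<Pi>\<^sub>M i\<in>(UNIV::'n set). (lborel :: real measure)) \<rightarrow>\<^sub>M borel"
    using measurable_vec_lambda_PiM by (simp cong: measurable_cong_sets)
  show "integrable lborel (\<lambda>x :: real ^ 'n. \<Prod>i\<in>UNIV. f i (x $ i))"
    unfolding lborel_vec_eq using product_integrable_prod[of UNIV f] assms
    by (subst integrable_distr_eq) auto
  show "(LINT x|(lborel :: (real ^ 'n) measure). (\<Prod>i\<in>UNIV. f i (x $ i))) = (\<Prod>i\<in>UNIV. (LINT x|lborel. f i x))"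
    using product_integral_prod[of UNIV f] assms
    by (subst lborel_vec_eq, subst integral_distr) auto
qed

lemma emeasure_lborel_box_vec:
  assumes "\<And>i. l $ i \<le> u $ i"
  shows "emeasure lborel (box l u) = ennreal (\<Prod>i\<in>UNIV. u $ i - l $ i)"
proof -
  have "l \<bullet> b \<le> u \<bullet> b" if "b \<in> Basis" for b
    using that assms by (auto simp: Basis_vec_def inner_axis)
  thus ?thesis
    by (simp add: emeasure_lborel_box prod_Basis_vec inner_axis)
qed

text \<open>
  The library's change of variables for linear maps is stated for well-ordered index types only. A
  finite linear order is a well-order, but this cannot be made an instance for a type variable;
  hence the detour through a copy of the index type.
\<close>

typedef 'a wo_copy = "UNIV :: 'a set"
  by simp

instance wo_copy :: (finite) finite
proof
  have "(UNIV :: 'a wo_copy set) = range Abs_wo_copy"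
    by (metis Rep_wo_copy_inverse surjI)
  thus "finite (UNIV :: 'a wo_copy set)"
    by (metis finite finite_imageI)
qed

instantiation wo_copy :: (linorder) linorder
begin

definition "x \<le> y \<longleftrightarrow> Rep_wo_copy x \<le> Rep_wo_copy y"
definition "x < y \<longleftrightarrow> Rep_wo_copy x < Rep_wo_copy y"

instance
  by standard
    (auto simp: less_eq_wo_copy_def less_wo_copy_def less_le_not_le simp flip: Rep_wo_copy_inject)

end

instance wo_copy :: ("{finite,linorder}") wellorder
proof
  fix P :: "'a wo_copy \<Rightarrow> bool" and a
  assume step: "\<And>x. (\<And>y. y < x \<Longrightarrow> P y) \<Longrightarrow> P x"
  show "P a"
  proof (induction "card {y. y < a}" arbitrary: a rule: less_induct)
    case less
    show ?case
    proof (rule step)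
      fix y assume "y < a"
      hence "{x. x < y} \<subset> {x. x < a}"
        by auto
      thus "P y"
        by (intro less psubset_card_mono) auto
    qed
  qed
qed

lemma bij_Rep_wo_copy: "bij Rep_wo_copy"
  by (metis Abs_wo_copy_inverse Rep_wo_copy_inject UNIV_I bijI injI surjI)

text \<open>The constant is |det g|: the preimage of a box under \<open>g\<close> is its image under
  the inverse \<open>h\<close>, which scales volumes by |det h|.\<close>

lemma lborel_linear_wellorder:
  fixes g :: "real ^ 'm::{finite,wellorder} \<Rightarrow> real ^ 'm::_"
  assumes "linear g" "inj g"
  shows "\<exists>c>0. lborel = density (distr lborel borel g) (\<lambda>_. ennreal c)"
proof -
  obtain h where h: "linear h" "\<And>x. h (g x) = x" "\<And>x. g (h x) = x"
    using linear_injective_isomorphism[OF assms] by metis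
  have [measurable]: "g \<in> borel_measurable borel"
    by (intro borel_measurable_continuous_onI linear_continuous_on linear_conv_bounded_linear[THEN iffD1] assms)
  define d where "d = \<bar>det (matrix h)\<bar>"
  have "inj h"
    using h(3) by (metis injI)
  hence d: "d > 0"
    using det_nz_iff_inj[OF h(1)] by (simp add: d_def)
  have "lborel = density (distr lborel borel g) (\<lambda>_. ennreal (1 / d))"
  proof (rule lborel_vec_eqI)
    fix l u :: "real ^ 'm::_"
    assume le: "\<And>i. l $ i \<le> u $ i"
    have "g -` box l u = h ` box l u"
    proof (intro set_eqI iffI)
      fix x assume "x \<in> g -` box l u"
      thus "x \<in> h ` box l u"
        by (intro image_eqI[of _ _ "g x"]) (simp_all add: h)
    qed (auto simp: h)
    moreover have "emeasure lebesgue (h ` box l u) = ennreal (d * measure lebesgue (box l u))"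
      using measurable_linear_image[OF h(1)] measure_linear_image[OF h(1)]
      by (simp add: emeasure_eq_measure2 d_def lmeasurable_box)
    moreover have "measure lebesgue (box l u) = (\<Prod>i\<in>UNIV. u $ i - l $ i)"
      using le by (simp add: measure_def emeasure_lborel_box_vec prod_nonneg)
    moreover have "g -` box l u \<in> sets borel"
      by (metis measurable_sets_borel \<open>g \<in> borel_measurable borel\<close> borel_open open_box)
    ultimately have "emeasure lborel (g -` box l u) = ennreal (d * (\<Prod>i\<in>UNIV. u $ i - l $ i))"
      by simp
    thus "emeasure (density (distr lborel borel g) (\<lambda>_. ennreal (1 / d))) (box l u) =
        ennreal (\<Prod>i\<in>UNIV. u $ i - l $ i)"
      using d le by (simp add: emeasure_density_const emeasure_distr ennreal_mult'[symmetric] prod_nonneg)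
  qed simp
  thus ?thesis
    using d by (intro exI[of _ "1 / d"]) auto
qed

text \<open>Renaming coordinates permutes the sides of boxes and so preserves \<open>lborel\<close>;
  hence the constant of the conjugated map \<open>g'\<close> serves for \<open>g\<close>.\<close>

lemma lborel_linear:
  fixes g :: "real ^ 'n::{finite,linorder} \<Rightarrow> real ^ 'n::_"
  assumes "linear g" "inj g"
  shows "\<exists>c>0. lborel = density (distr lborel borel g) (\<lambda>_. ennreal c)"
proof -
  define R :: "real ^ 'n::_ \<Rightarrow> real ^ ('n::_ wo_copy)" where "R x = (\<chi> i. x $ Rep_wo_copy i)" for x
  define R' :: "real ^ ('n::_ wo_copy) \<Rightarrow> real ^ 'n::_" where "R' x = (\<chi> i. x $ Abs_wo_copy i)" for x
  have RR: "R' (R x) = x" "R (R' y) = y" for x y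
    by (simp_all add: R_def R'_def vec_eq_iff Abs_wo_copy_inverse Rep_wo_copy_inverse)
  have lin: "linear R" "linear R'"
    by (simp_all add: R_def R'_def linear_iff vec_eq_iff)
  have [measurable]: "R \<in> borel_measurable borel" "R' \<in> borel_measurable borel" "g \<in> borel_measurable borel"
    by (intro borel_measurable_continuous_onI linear_continuous_on linear_conv_bounded_linear[THEN iffD1] lin assms)+
  have distr_R: "lborel = distr lborel borel R"
  proof (rule lborel_vec_eqI)
    fix l u :: "real ^ ('n::_ wo_copy)"
    assume le: "\<And>i. l $ i \<le> u $ i"
    have "R -` box l u = box (R' l) (R' u)"
      by (auto simp: mem_box_cart R_def R'_def) (metis Abs_wo_copy_inverse Rep_wo_copy_inverse UNIV_I)+
    moreover have "(\<Prod>i\<in>UNIV. R' u $ i - R' l $ i) = (\<Prod>i\<in>UNIV. u $ i - l $ i)"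
      by (rule prod.reindex_bij_betw[OF bij_Rep_wo_copy, symmetric, THEN trans])
         (simp add: R'_def Rep_wo_copy_inverse)
    moreover have "emeasure lborel (box (R' l) (R' u)) = ennreal (\<Prod>i\<in>UNIV. R' u $ i - R' l $ i)"
      using le by (intro emeasure_lborel_box_vec) (simp add: R'_def)
    ultimately show "emeasure (distr lborel borel R) (box l u) = ennreal (\<Prod>i\<in>UNIV. u $ i - l $ i)"
      by (simp add: emeasure_distr)
  qed simp
  have distr_R': "distr lborel borel R' = lborel"
    by (subst distr_R, subst distr_distr) (auto simp: comp_def RR distr_id2)
  define g' where "g' = R \<circ> g \<circ> R'"
  have "linear g'"
    unfolding g'_def by (intro linear_compose lin assms)
  moreover have "inj g'"
  proof (rule injI)
    fix x y assume "g' x = g' y"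
    hence "R' (g' x) = R' (g' y)"
      by simp
    hence "R' x = R' y"
      using assms(2) by (simp add: g'_def RR inj_eq)
    hence "R (R' x) = R (R' y)"
      by simp
    thus "x = y"
      by (simp only: RR)
  qed
  ultimately obtain c where c: "c > 0" "lborel = density (distr lborel borel g') (\<lambda>_. ennreal c)"
    using lborel_linear_wellorder by blast
  have [measurable]: "g' \<in> borel_measurable borel"
    unfolding g'_def comp_def by measurable
  have "lborel = distr (density (distr lborel borel g') (\<lambda>_. ennreal c)) borel R'"
    using c(2) distr_R' by simp
  also have "\<dots> = density (distr (distr lborel borel g') borel R') (\<lambda>_. ennreal c)"
    by (rule density_distr[symmetric]) auto
  also have "distr (distr lborel borel g') borel R' = distr (distr lborel borel R') borel g"
    by (simp add: distr_distr comp_def g'_def RR)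
  finally show ?thesis
    using c(1) distr_R' by auto
qed

section \<open>Gaussian laws with diagonal covariance\<close>

text \<open>An image rather than a density of its own, so that \<open>s i = 0\<close> is harmless
  and integrals have the form that the substitution u = g x produces below.\<close>

definition diagonal_gaussian :: "('n::finite \<Rightarrow> real) \<Rightarrow> (real ^ 'n) measure" where
  "diagonal_gaussian s = distr (density lborel (\<lambda>x. ennreal (\<Prod>i\<in>UNIV. std_normal_density (x $ i)))) borel
     (\<lambda>x. \<chi> i. s i * x $ i)"

lemma measurable_scale_components [measurable]:
  "(\<lambda>x :: real ^ 'n. (\<chi> i. s i * x $ i) :: real ^ 'n) \<in> borel_measurable borel"
  by (intro borel_measurable_continuous_onI continuous_on_vec_lambda continuous_intros)

lemma integral_diagonal_gaussian:
  fixes f :: "real ^ 'n \<Rightarrow> 'b::{banach,second_countable_topology}"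
  assumes [measurable]: "f \<in> borel_measurable borel"
  shows "(LINT x|diagonal_gaussian s. f x) =
    (LINT x|lborel. (\<Prod>i\<in>UNIV. std_normal_density (x $ i)) *\<^sub>R f (\<chi> i. s i * x $ i))"
  unfolding diagonal_gaussian_def
  by (simp add: integral_distr integral_density prod_nonneg)

lemma prob_space_diagonal_gaussian: "prob_space (diagonal_gaussian s :: (real ^ 'n) measure)"
proof -
  let ?d = "\<lambda>x :: real ^ 'n. \<Prod>i\<in>UNIV. std_normal_density (x $ i)"
  have "integrable lborel ?d" "integral\<^sup>L lborel ?d = 1"
    using lborel_vec_prod[of "\<lambda>_ :: 'n. std_normal_density"] by simp_all
  hence "(\<integral>\<^sup>+x. ennreal (?d x) \<partial>lborel) = 1"
    by (subst nn_integral_eq_integral) (simp_all add: prod_nonneg)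
  hence "prob_space (density lborel (\<lambda>x. ennreal (?d x)))"
    by (intro prob_spaceI) (simp add: emeasure_density)
  thus ?thesis
    unfolding diagonal_gaussian_def by (rule prob_space.prob_space_distr) simp
qed

text \<open>\<open>iexp (t \<bullet> x)\<close> factorises over the coordinates, so the
  characteristic function is the product of those of the standard normal law at
  \<open>t $ i * s i\<close>.\<close>

lemma centered_gaussian_diagonal_gaussian:
  fixes s :: "'n::finite \<Rightarrow> real"
  shows "centered_gaussian (\<chi> i j. if i = j then (s i)\<^sup>2 else 0) (diagonal_gaussian s)"
  unfolding centered_gaussian_def
proof (intro conjI allI)
  show "sets (diagonal_gaussian s) = sets borel"
    by (simp add: diagonal_gaussian_def)
  fix t :: "real ^ 'n"
  let ?f = "\<lambda>i x. std_normal_density x *\<^sub>R iexp (t $ i * s i * x)"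
  have int: "integrable lborel (?f i)" for i
  proof -
    have "integrable std_normal_distribution (\<lambda>x. iexp (t $ i * s i * x))"
    proof -
      interpret real_distribution std_normal_distribution
        by (rule real_dist_normal_dist)
      show ?thesis
        by (rule integrable_iexp) auto
    qed
    thus ?thesis
      by (subst (asm) integrable_density) auto
  qed
  have "(CLINT x|diagonal_gaussian s. iexp (t \<bullet> x)) =
    (CLINT x|lborel. (\<Prod>i\<in>UNIV. std_normal_density (x $ i)) *\<^sub>R iexp (t \<bullet> (\<chi> i. s i * x $ i)))"
    by (rule integral_diagonal_gaussian) simp
  also have "\<dots> = (CLINT x|lborel. \<Prod>i\<in>UNIV. ?f i (x $ i))"
  proof (rule Bochner_Integration.integral_cong)
    fix x :: "real ^ 'n"
    have "iexp (t \<bullet> (\<chi> i. s i * x $ i)) = (\<Prod>i\<in>UNIV. iexp (t $ i * s i * x $ i))"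
      by (simp add: inner_vec_def exp_sum sum_distrib_left mult_ac)
    thus "(\<Prod>i\<in>UNIV. std_normal_density (x $ i)) *\<^sub>R iexp (t \<bullet> (\<chi> i. s i * x $ i)) = (\<Prod>i\<in>UNIV. ?f i (x $ i))"
      by (simp add: scaleR_conv_of_real prod.distrib)
  qed simp
  also have "\<dots> = (\<Prod>i\<in>UNIV. (CLINT x|lborel. ?f i x))"
    by (rule lborel_vec_prod(2)[OF int])
  also have "\<dots> = (\<Prod>i\<in>UNIV. char std_normal_distribution (t $ i * s i))"
    unfolding char_def by (intro prod.cong refl) (subst integral_density; simp)
  also have "\<dots> = complex_of_real (\<Prod>i\<in>UNIV. exp (- ((t $ i * s i)\<^sup>2) / 2))"
    by (simp add: char_std_normal_distribution)
  also have "(\<Prod>i\<in>UNIV. exp (- ((t $ i * s i)\<^sup>2) / 2)) = exp (\<Sum>i\<in>UNIV. - ((t $ i * s i)\<^sup>2) / 2)"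
    by (simp add: exp_sum)
  also have "(\<Sum>i\<in>UNIV. - ((t $ i * s i)\<^sup>2) / 2) = - (t \<bullet> ((\<chi> i j. if i = j then (s i)\<^sup>2 else 0) *v t)) / 2"
  proof -
    have "((\<chi> i j. if i = j then (s i)\<^sup>2 else 0) *v t) $ i = (s i)\<^sup>2 * t $ i" for i
      by (simp add: matrix_vector_mult_def if_distrib[of "\<lambda>x. x * _"] cong: if_cong)
    thus ?thesis
      by (simp add: inner_vec_def sum_divide_distrib sum_negf power2_eq_square mult_ac)
  qed
  finally show "(CLINT x|diagonal_gaussian s. iexp (t \<bullet> x)) =
    complex_of_real (exp (- (t \<bullet> ((\<chi> i j. if i = j then (s i)\<^sup>2 else 0) *v t)) / 2))" .
qed (rule prob_space_diagonal_gaussian)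

text \<open>
  The coordinates \<open>u = g x\<close> diagonalise the quadratic form \<open>H\<close> and the linear map \<open>T\<close> at the same time.
\<close>

lemma integral_quadratic_form_gaussian:
  fixes g T :: "real ^ 'n::{finite,linorder} \<Rightarrow> real ^ 'n::_"
  assumes g: "linear g" and [measurable]: "T \<in> borel_measurable borel"
    and [measurable]: "H \<in> borel_measurable borel"
    and H: "\<And>x. H (g x) = (\<Sum>i\<in>UNIV. (x $ i)\<^sup>2)"
    and T: "\<And>x. T (g x) = (\<chi> i. s i * x $ i)"
  shows "\<exists>K>0. \<forall>f :: real ^ 'n::_ \<Rightarrow> real. f \<in> borel_measurable borel \<longrightarrow>
    (LINT x|lborel. exp (- H x / 2) * f (T x)) = K * (LINT x|diagonal_gaussian s. f x)"
proof -
  \<comment> \<open>By \<open>H\<close>, a kernel vector of \<open>g\<close> has the same sum of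
    squares as 0.\<close>
  have "inj g"
    unfolding linear_injective_0[OF g]
  proof (intro allI impI)
    fix x assume "g x = 0"
    hence "H (g x) = H (g 0)"
      using linear_0[OF g] by simp
    hence "(\<Sum>i\<in>UNIV. (x $ i)\<^sup>2) = 0"
      unfolding H by simp
    thus "x = 0"
      by (simp add: sum_nonneg_eq_0_iff vec_eq_iff)
  qed
  then obtain c where c: "c > 0" "lborel = density (distr lborel borel g) (\<lambda>_. ennreal c)"
    using lborel_linear[OF g] by blast
  have [measurable]: "g \<in> borel_measurable borel"
    by (intro borel_measurable_continuous_onI linear_continuous_on linear_conv_bounded_linear[THEN iffD1] g)
  \<comment> \<open>The normalising factors of the standard normal densities; with the Jacobian
    factor \<open>c\<close> they make up \<open>K\<close>.\<close>
  define d where "d = (sqrt (2 * pi)) ^ CARD('n)"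
  have d: "d > 0"
    by (simp add: d_def)
  have density: "exp (- (\<Sum>i\<in>UNIV. (x $ i)\<^sup>2) / 2) = d * (\<Prod>i\<in>UNIV. std_normal_density (x $ i))" for x :: "real ^ 'n::_"
    by (simp add: std_normal_density_def d_def prod.distrib exp_sum power_divide sum_divide_distrib sum_negf[symmetric]
        prod_dividef)
  have "(LINT x|lborel. exp (- H x / 2) * f (T x)) = c * d * (LINT x|diagonal_gaussian s. f x)"
    if [measurable]: "f \<in> borel_measurable borel" for f :: "real ^ 'n::_ \<Rightarrow> real"
  proof -
    have "(LINT x|lborel. exp (- H x / 2) * f (T x)) =
      (LINT x|density (distr lborel borel g) (\<lambda>_. ennreal c). exp (- H x / 2) * f (T x))"
      by (subst c(2)) simp
    also have "\<dots> = (LINT x|lborel. c * (exp (- H (g x) / 2) * f (T (g x))))"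
      using c(1) by (subst integral_density) (auto simp: integral_distr)
    also have "\<dots> = (LINT x|lborel. c * d * ((\<Prod>i\<in>UNIV. std_normal_density (x $ i)) *\<^sub>R f (\<chi> i. s i * x $ i)))"
      unfolding H T density by (simp add: mult_ac)
    also have "\<dots> = c * d * (LINT x|diagonal_gaussian s. f x)"
      by (subst integral_diagonal_gaussian) simp_all
    finally show ?thesis .
  qed
  thus ?thesis
    using c(1) d by (intro exI[of _ "c * d"]) auto
qed

section \<open>Laplace asymptotics of the ensemble\<close>

definition ln_gap :: "real \<Rightarrow> real" where
  "ln_gap s = s - 1 - ln s"

lemma ln_gap_nonneg: "s > 0 \<Longrightarrow> ln_gap s \<ge> 0"
  using ln_le_minus_one[of s] by (simp add: ln_gap_def)

lemma exp_ln_gap: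
  assumes "s > 0"
  shows "exp (- k * ln_gap s) = s powr k * exp (- k * (s - 1))"
  using assms by (simp add: ln_gap_def powr_def flip: exp_add) (simp add: algebra_simps)

text \<open>One unit of \<open>k\<close> pays for the division by \<open>s\<close>: k times the gap
  plus ln s is k - 1 times the gap plus s - 1. As k - 1 \<ge> k / 2, a quadratic exponent in sqrt k
  (sqrt s - 1) remains. The final exponent is linear in s - 1 since the gap itself grows linearly at
  infinity.\<close>

lemma exp_ln_gap_bound:
  assumes "s > 0" "k \<ge> 2"
  shows "exp (- k * ln_gap s) / s \<le> exp (3 / 2) * exp (- \<bar>sqrt k * (s - 1)\<bar> / 4)"
proof -
  \<comment> \<open>Passing to the square root gives ln s \<le> 2 y and hence a gap of at least y^2
    for every s > 0, near 0 as well as at infinity.\<close>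
  define y where "y = sqrt s - 1"
  define x where "x = sqrt k * \<bar>y\<bar>"
  have y: "s - 1 = y\<^sup>2 + 2 * y" "sqrt s = 1 + y"
    using assms(1) by (simp_all add: y_def power2_eq_square algebra_simps)
  have "ln s = 2 * ln (sqrt s)"
    using assms(1) by (simp add: ln_sqrt)
  also have "\<dots> \<le> 2 * y"
    using ln_le_minus_one[of "sqrt s"] assms(1) by (simp add: y_def)
  finally have gap: "y\<^sup>2 \<le> ln_gap s"
    unfolding ln_gap_def y(1) by simp
  have k: "1 \<le> sqrt k"
    using assms(2) by simp
  have x2: "x\<^sup>2 = k * y\<^sup>2"
    using assms(2) by (simp add: x_def power_mult_distrib)
  have "\<bar>sqrt k * (s - 1)\<bar> = sqrt k * \<bar>y\<^sup>2 + 2 * y\<bar>"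
    using assms(2) by (simp add: y(1) abs_mult)
  also have "\<dots> \<le> sqrt k * (y\<^sup>2 + 2 * \<bar>y\<bar>)"
    using k by (intro mult_left_mono order.trans[OF abs_triangle_ineq]) (auto simp: abs_mult)
  also have "\<dots> = sqrt k * y\<^sup>2 + 2 * x"
    by (simp add: x_def algebra_simps)
  also have "sqrt k * y\<^sup>2 \<le> k * y\<^sup>2"
    using k assms(2) by (intro mult_right_mono) (auto simp: real_le_lsqrt power2_eq_square)
  finally have r: "\<bar>sqrt k * (s - 1)\<bar> \<le> x\<^sup>2 + 2 * x"
    using x2 by simp
  have "k / 2 * y\<^sup>2 \<le> (k - 1) * ln_gap s"
    using gap assms by (intro mult_mono) (auto simp: ln_gap_nonneg)
  \<comment> \<open>Completing the square: 1 - x^2 / 2 \<le> 5 / 4 - (x^2 + 2 x) / 4, so the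
    constant 3 / 2 leaves room.\<close>
  moreover have "(x - 1)\<^sup>2 \<ge> 0"
    by simp
  ultimately have "- k * ln_gap s - ln s \<le> 3 / 2 - \<bar>sqrt k * (s - 1)\<bar> / 4 - s"
    using r x2 by (simp add: ln_gap_def power2_eq_square algebra_simps)
  also have "\<dots> \<le> 3 / 2 - \<bar>sqrt k * (s - 1)\<bar> / 4"
    using assms(1) by simp
  finally have "exp (- k * ln_gap s - ln s) \<le> exp (3 / 2 - \<bar>sqrt k * (s - 1)\<bar> / 4)"
    by simp
  also have "exp (- k * ln_gap s - ln s) = exp (- k * ln_gap s) / s"
    using assms(1) by (simp add: exp_diff)
  also have "exp (3 / 2 - \<bar>sqrt k * (s - 1)\<bar> / 4) = exp (3 / 2) * exp (- \<bar>sqrt k * (s - 1)\<bar> / 4)"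
    by (simp flip: exp_add)
  finally show ?thesis .
qed

lemma filterlim_sqrt_two_over: "((\<lambda>b. sqrt (2 / b)) \<longlongrightarrow> 0) at_top"
  by real_asymp

text \<open>\<open>ln_gap (1 + h)\<close> behaves like h^2 / 2, and b / 2 is the inverse square of
  the step sqrt (2 / b). The limit at 0 runs over nonzero arguments, so v = 0 is split off.\<close>

lemma ln_gap_limit: "((\<lambda>b. b / 2 * ln_gap (1 + sqrt (2 / b) * v)) \<longlongrightarrow> v\<^sup>2 / 2) at_top"
proof (cases "v = 0")
  case False
  have 1: "((\<lambda>x::real. (x - ln (1 + x)) / x\<^sup>2) \<longlongrightarrow> 1 / 2) (at 0)"
    by real_asymp
  have "((\<lambda>b. sqrt (2 / b) * v) \<longlongrightarrow> 0) at_top"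
    by (rule tendsto_mult_left_zero[OF filterlim_sqrt_two_over])
  moreover have "\<forall>\<^sub>F b in at_top. sqrt (2 / b) * v \<noteq> 0"
    using eventually_gt_at_top[of 0] by eventually_elim (use False in auto)
  ultimately have "filterlim (\<lambda>b. sqrt (2 / b) * v) (at 0) at_top"
    by (simp add: filterlim_at)
  from tendsto_mult_left[OF filterlim_compose[OF 1 this], of "v\<^sup>2"]
  have "((\<lambda>b. v\<^sup>2 * ((sqrt (2 / b) * v - ln (1 + sqrt (2 / b) * v)) / (sqrt (2 / b) * v)\<^sup>2)) \<longlongrightarrow> v\<^sup>2 / 2) at_top"
    by simp
  moreover have "\<forall>\<^sub>F b in at_top. v\<^sup>2 * ((sqrt (2 / b) * v - ln (1 + sqrt (2 / b) * v)) / (sqrt (2 / b) * v)\<^sup>2) =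
    b / 2 * ln_gap (1 + sqrt (2 / b) * v)"
    using eventually_gt_at_top[of 0]
    by eventually_elim (use False in \<open>simp add: ln_gap_def power_mult_distrib field_simps\<close>)
  ultimately show ?thesis
    by (rule Lim_transform_eventually)
qed (simp add: ln_gap_def)

section \<open>Centring the weight at the zeros\<close>

lemma sum_pairs_less:
  fixes F :: "'n::{finite,linorder} \<Rightarrow> 'n \<Rightarrow> real"
  assumes "\<And>i j. F i j = F j i" "\<And>i. F i i = 0"
  shows "(\<Sum>i\<in>UNIV. \<Sum>j\<in>UNIV. F i j) = 2 * (\<Sum>(i, j)\<in>{(i, j). i < j}. F i j)"
proof -
  let ?A = "{(i, j). i < (j :: 'n)}" and ?B = "{(i, j). j < (i :: 'n)}" and ?C = "{(i, j). i = (j :: 'n)}"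
  have "(\<Sum>i\<in>UNIV. \<Sum>j\<in>UNIV. F i j) = (\<Sum>(i, j)\<in>UNIV. F i j)"
    by (simp add: sum.cartesian_product)
  also have "(UNIV :: ('n \<times> 'n) set) = ?A \<union> ?B \<union> ?C"
    by auto
  also have "(\<Sum>(i, j)\<in>\<dots>. F i j) = (\<Sum>(i, j)\<in>?A. F i j) + (\<Sum>(i, j)\<in>?B. F i j) + (\<Sum>(i, j)\<in>?C. F i j)"
    by (subst sum.union_disjoint; (subst sum.union_disjoint)?; auto)
  also have "(\<Sum>(i, j)\<in>?C. F i j) = 0"
    using assms(2) by (intro sum.neutral) auto
  also have "(\<Sum>(i, j)\<in>?B. F i j) = (\<Sum>(i, j)\<in>?A. F i j)"
    by (rule sum.reindex_bij_witness[of _ prod.swap prod.swap]) (auto simp: assms(1))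
  finally show ?thesis
    by simp
qed

text \<open>Criticality along a direction \<open>y\<close>, grouped into the first-order parts s - 1
  of the gap terms; it makes the linear exponents cancel in
  \<open>beta_laguerre_weight_eq_kernel\<close>.\<close>

lemma log_gas_critical_sum:
  fixes z :: "real ^ 'n::{finite,linorder}"
  assumes crit: "\<And>i. 1 = a / z $ i + 2 * (\<Sum>j\<in>UNIV. 1 / (z $ i - z $ j))"
  shows "(\<Sum>i\<in>UNIV. y i) = a * (\<Sum>i\<in>UNIV. y i / z $ i) +
    2 * (\<Sum>(i, j)\<in>{(i, j). i < j}. (y j - y i) / (z $ j - z $ i))"
proof -
  have "(\<Sum>i\<in>UNIV. y i) = (\<Sum>i\<in>UNIV. y i * (a / z $ i + 2 * (\<Sum>j\<in>UNIV. 1 / (z $ i - z $ j))))"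
    by (subst crit[symmetric]) simp
  also have "\<dots> = a * (\<Sum>i\<in>UNIV. y i / z $ i) + 2 * (\<Sum>i\<in>UNIV. y i * (\<Sum>j\<in>UNIV. 1 / (z $ i - z $ j)))"
    by (simp add: distrib_left sum.distrib sum_distrib_left mult_ac)
  also have "2 * (\<Sum>i\<in>UNIV. y i * (\<Sum>j\<in>UNIV. 1 / (z $ i - z $ j))) =
    (\<Sum>i\<in>UNIV. \<Sum>j\<in>UNIV. (y i - y j) * (1 / (z $ i - z $ j)))"
    by (rule sum_antisymmetric[symmetric]) (metis minus_diff_eq minus_divide_right)
  also have "\<dots> = 2 * (\<Sum>(i, j)\<in>{(i, j). i < j}. (y i - y j) * (1 / (z $ i - z $ j)))"
    by (rule sum_pairs_less) (auto simp: divide_simps, auto simp: algebra_simps)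
  also have "(\<Sum>(i, j)\<in>{(i, j). i < j}. (y i - y j) * (1 / (z $ i - z $ j))) =
    (\<Sum>(i, j)\<in>{(i, j). i < j}. (y j - y i) / (z $ j - z $ i))"
    by (rule sum.cong) (auto simp: divide_simps, auto simp: algebra_simps)
  finally show ?thesis .
qed

text \<open>For critical \<open>z\<close> this is the weight divided by its value at
  \<open>z\<close>. The division by \<open>x $ i / z $ i\<close> comes from the -1 in the exponent
  of the weight.\<close>

definition laplace_kernel :: "real \<Rightarrow> real \<Rightarrow> real ^ 'n::{finite,linorder} \<Rightarrow> real ^ 'n::{finite,linorder} \<Rightarrow> real" where
  "laplace_kernel b a z x = (if (\<forall>i. 0 < x $ i) \<and> strictly_increasing x then
     (\<Prod>i\<in>UNIV. exp (- (b / 2 * a) * ln_gap (x $ i / z $ i)) / (x $ i / z $ i)) *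
     (\<Prod>(i, j)\<in>{(i, j). i < j}. exp (- b * ln_gap ((x $ j - x $ i) / (z $ j - z $ i))))
   else 0)"

text \<open>Each power splits by \<open>exp_ln_gap\<close> into a gap factor and exp (k (s - 1));
  the latter, together with the exponential part of the weight relative to \<open>z\<close>,
  multiply to 1 because \<open>z\<close> is critical.\<close>

lemma beta_laguerre_weight_eq_kernel:
  fixes z :: "real ^ 'n::{finite,linorder}"
  assumes z: "\<And>i. z $ i > 0" "strictly_increasing z"
    and crit: "\<And>i. 1 = a / z $ i + 2 * (\<Sum>j\<in>UNIV. 1 / (z $ i - z $ j))"
  shows "\<exists>C>0. \<forall>x. beta_laguerre_weight b a x = C * laplace_kernel b a z x"
proof -
  define k where "k = b / 2 * a"
  define P where "P = {(i, j). i < (j :: 'n)}"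
  define C where "C = (\<Prod>i\<in>UNIV. z $ i powr (k - 1) * exp (- (b / 2) * z $ i)) * (\<Prod>(i, j)\<in>P. (z $ j - z $ i) powr b)"
  have dz: "z $ j - z $ i > 0" if "(i, j) \<in> P" for i j
    using z(2) that by (auto simp: strictly_increasing_def P_def)
  have C: "C > 0"
    unfolding C_def using z(1) dz by (intro mult_pos_pos prod_pos) (auto simp: less_imp_neq[symmetric])
  have "beta_laguerre_weight b a x = C * laplace_kernel b a z x" for x
  proof (cases "(\<forall>i. 0 < x $ i) \<and> strictly_increasing x")
    case True
    hence x: "\<And>i. x $ i > 0" and dx: "\<And>i j. (i, j) \<in> P \<Longrightarrow> x $ j - x $ i > 0"
      by (auto simp: strictly_increasing_def P_def)
    define y where "y i = x $ i - z $ i" for i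
    define A where "A = (\<Prod>i\<in>UNIV. z $ i powr (k - 1) * exp (- (b / 2) * z $ i))"
    define A' where "A' = (\<Prod>i\<in>UNIV. exp (- k * ln_gap (x $ i / z $ i)) / (x $ i / z $ i))"
    define B where "B = (\<Prod>(i, j)\<in>P. (z $ j - z $ i) powr b)"
    define B' where "B' = (\<Prod>(i, j)\<in>P. exp (- b * ln_gap ((x $ j - x $ i) / (z $ j - z $ i))))"
    have fac: "x $ i powr (k - 1) * exp (- (b / 2) * x $ i) =
      z $ i powr (k - 1) * exp (- (b / 2) * z $ i) * (exp (- k * ln_gap (x $ i / z $ i)) / (x $ i / z $ i)) *
      exp (k * (y i / z $ i) - b / 2 * y i)" for i
    proof -
      have s: "x $ i / z $ i > 0" "x $ i / z $ i - 1 = y i / z $ i"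
        using x z(1) by (auto simp: y_def diff_divide_distrib) (metis less_irrefl)
      have "x $ i powr (k - 1) = z $ i powr (k - 1) * (x $ i / z $ i) powr (k - 1)"
        using x[of i] z(1)[of i] by (simp add: powr_divide)
      also have "(x $ i / z $ i) powr (k - 1) = (x $ i / z $ i) powr k / (x $ i / z $ i)"
        using x[of i] z(1)[of i] by (simp add: powr_diff)
      also have "(x $ i / z $ i) powr k = exp (- k * ln_gap (x $ i / z $ i)) * exp (k * (y i / z $ i))"
        using exp_ln_gap[OF s(1), of k] by (simp add: s(2) flip: exp_add)
      finally have "x $ i powr (k - 1) * exp (- (b / 2) * x $ i) =
        z $ i powr (k - 1) * (exp (- k * ln_gap (x $ i / z $ i)) / (x $ i / z $ i)) *
        (exp (k * (y i / z $ i)) * exp (- (b / 2) * x $ i))"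
        by simp
      also have "exp (k * (y i / z $ i)) * exp (- (b / 2) * x $ i) =
        exp (- (b / 2) * z $ i) * exp (k * (y i / z $ i) - b / 2 * y i)"
        unfolding exp_add[symmetric] by (simp add: y_def algebra_simps)
      finally show ?thesis
        by (simp only: mult_ac)
    qed
    have fac2: "\<bar>x $ j - x $ i\<bar> powr b = (z $ j - z $ i) powr b *
      exp (- b * ln_gap ((x $ j - x $ i) / (z $ j - z $ i))) * exp (b * ((y j - y i) / (z $ j - z $ i)))"
      if "(i, j) \<in> P" for i j
    proof -
      define r where "r = (x $ j - x $ i) / (z $ j - z $ i)"
      have r: "r > 0" "r - 1 = (y j - y i) / (z $ j - z $ i)"
        using dx[OF that] dz[OF that] by (auto simp: r_def y_def field_simps)
      have "\<bar>x $ j - x $ i\<bar> powr b = (z $ j - z $ i) powr b * r powr b"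
        using dx[OF that] dz[OF that] by (simp add: r_def powr_divide)
      also have "r powr b = exp (- b * ln_gap r) * exp (b * (r - 1))"
        using exp_ln_gap[OF r(1), of b] by (simp flip: exp_add)
      finally show ?thesis
        unfolding r(2) unfolding r_def by (simp only: mult.assoc)
    qed
    have "beta_laguerre_weight b a x = (\<Prod>(i, j)\<in>P. \<bar>x $ j - x $ i\<bar> powr b) *
      (\<Prod>i\<in>UNIV. x $ i powr (k - 1) * exp (- (b / 2) * x $ i))"
      using True by (simp add: beta_laguerre_weight_def k_def P_def)
    also have "(\<Prod>i\<in>UNIV. x $ i powr (k - 1) * exp (- (b / 2) * x $ i)) =
      A * A' * exp (\<Sum>i\<in>UNIV. k * (y i / z $ i) - b / 2 * y i)"
      unfolding fac A_def A'_def by (simp only: prod.distrib exp_sum finite)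
    also have "(\<Prod>(i, j)\<in>P. \<bar>x $ j - x $ i\<bar> powr b) =
      (\<Prod>p\<in>P. (case p of (i, j) \<Rightarrow> (z $ j - z $ i) powr b) *
        (case p of (i, j) \<Rightarrow> exp (- b * ln_gap ((x $ j - x $ i) / (z $ j - z $ i)))) *
        exp (case p of (i, j) \<Rightarrow> b * ((y j - y i) / (z $ j - z $ i))))"
      using fac2 by (intro prod.cong) auto
    also have "\<dots> = B * B' * exp (\<Sum>(i, j)\<in>P. b * ((y j - y i) / (z $ j - z $ i)))"
      unfolding B_def B'_def by (simp only: prod.distrib exp_sum finite)
    also have "B * B' * exp (\<Sum>(i, j)\<in>P. b * ((y j - y i) / (z $ j - z $ i))) *
      (A * A' * exp (\<Sum>i\<in>UNIV. k * (y i / z $ i) - b / 2 * y i)) =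
      A * B * (A' * B') * exp ((\<Sum>(i, j)\<in>P. b * ((y j - y i) / (z $ j - z $ i))) +
        (\<Sum>i\<in>UNIV. k * (y i / z $ i) - b / 2 * y i))"
      by (simp add: exp_add)
    also have "(\<Sum>(i, j)\<in>P. b * ((y j - y i) / (z $ j - z $ i))) = b * (\<Sum>(i, j)\<in>P. (y j - y i) / (z $ j - z $ i))"
      by (simp add: sum_distrib_left case_prod_unfold)
    also have "(\<Sum>i\<in>UNIV. k * (y i / z $ i) - b / 2 * y i) = k * (\<Sum>i\<in>UNIV. y i / z $ i) - b / 2 * (\<Sum>i\<in>UNIV. y i)"
      by (simp add: sum_distrib_left sum_subtractf)
    also have "b * (\<Sum>(i, j)\<in>P. (y j - y i) / (z $ j - z $ i)) + (k * (\<Sum>i\<in>UNIV. y i / z $ i) - b / 2 * (\<Sum>i\<in>UNIV. y i)) = 0"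
      unfolding log_gas_critical_sum[OF crit, of y] by (simp add: k_def P_def algebra_simps)
    finally show ?thesis
      using True by (simp add: laplace_kernel_def A_def B_def A'_def B'_def C_def k_def P_def)
  next
    case False
    show ?thesis
      unfolding beta_laguerre_weight_def laplace_kernel_def if_not_P[OF False] by simp
  qed
  with C show ?thesis
    by blast
qed

text \<open>Gaps are nonnegative, so pair factors are at most 1, and \<open>exp_ln_gap_bound\<close>
  controls the one-particle factors. Since sqrt (b / 2 * a) * sqrt (2 / b) = sqrt a, the majorant
  does not depend on \<open>b\<close>.\<close>

lemma laplace_kernel_bound:
  fixes z :: "real ^ 'n::{finite,linorder}"
  assumes z: "\<And>i. z $ i > 0" "strictly_increasing z" and "a > 0" "b > 0" "b / 2 * a \<ge> 2"
  shows "0 \<le> laplace_kernel b a z (z + sqrt (2 / b) *\<^sub>R u)"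
    and "laplace_kernel b a z (z + sqrt (2 / b) *\<^sub>R u) \<le>
      (\<Prod>i\<in>UNIV. exp (3 / 2) * exp (- (sqrt a / (4 * z $ i)) * \<bar>u $ i\<bar>))"
proof -
  define x where "x = z + sqrt (2 / b) *\<^sub>R u"
  define E where "E = (\<Prod>(i, j)\<in>{(i, j). i < j}. exp (- b * ln_gap ((x $ j - x $ i) / (z $ j - z $ i))))"
  show "0 \<le> laplace_kernel b a z (z + sqrt (2 / b) *\<^sub>R u)"
    unfolding laplace_kernel_def using z(1)
    by (auto intro!: mult_nonneg_nonneg prod_nonneg simp: less_imp_le)
  show "laplace_kernel b a z (z + sqrt (2 / b) *\<^sub>R u) \<le>
      (\<Prod>i\<in>UNIV. exp (3 / 2) * exp (- (sqrt a / (4 * z $ i)) * \<bar>u $ i\<bar>))"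
  proof (cases "(\<forall>i. 0 < x $ i) \<and> strictly_increasing x")
    case True
    have gap: "ln_gap ((x $ j - x $ i) / (z $ j - z $ i)) \<ge> 0" if "i < j" for i j
      using True z(2) that by (intro ln_gap_nonneg divide_pos_pos) (auto simp: strictly_increasing_def)
    have E: "0 \<le> E" "E \<le> 1"
      unfolding E_def using gap assms(4) by (auto intro!: prod_nonneg prod_le_1)
    have A: "exp (- (b / 2 * a) * ln_gap (x $ i / z $ i)) / (x $ i / z $ i) \<le>
      exp (3 / 2) * exp (- (sqrt a / (4 * z $ i)) * \<bar>u $ i\<bar>)" for i
    proof -
      have "sqrt (b / 2 * a) * (x $ i / z $ i - 1) = sqrt (b / 2 * a) * sqrt (2 / b) * (u $ i / z $ i)"
        using z(1)[of i] by (simp add: x_def field_simps)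
      also have "sqrt (b / 2 * a) * sqrt (2 / b) = sqrt a"
        using assms(4) by (simp flip: real_sqrt_mult)
      finally have *: "- \<bar>sqrt (b / 2 * a) * (x $ i / z $ i - 1)\<bar> / 4 = - (sqrt a / (4 * z $ i)) * \<bar>u $ i\<bar>"
        using z(1)[of i] assms(3) by (simp add: abs_mult)
      show ?thesis
        using exp_ln_gap_bound[of "x $ i / z $ i" "b / 2 * a"] True z(1)[of i] assms(5)
        unfolding * by simp
    qed
    have nonneg: "0 \<le> exp (- (b / 2 * a) * ln_gap (x $ i / z $ i)) / (x $ i / z $ i)" for i
      using True z(1)[of i] by (simp add: less_imp_le)
    have "laplace_kernel b a z x = (\<Prod>i\<in>UNIV. exp (- (b / 2 * a) * ln_gap (x $ i / z $ i)) / (x $ i / z $ i)) * E"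
      using True by (simp add: laplace_kernel_def E_def)
    also have "\<dots> \<le> (\<Prod>i\<in>UNIV. exp (- (b / 2 * a) * ln_gap (x $ i / z $ i)) / (x $ i / z $ i))"
      using E nonneg by (intro mult_right_le_one_le prod_nonneg) auto
    also have "\<dots> \<le> (\<Prod>i\<in>UNIV. exp (3 / 2) * exp (- (sqrt a / (4 * z $ i)) * \<bar>u $ i\<bar>))"
      by (intro prod_mono conjI nonneg A)
    finally show ?thesis
      by (simp add: x_def)
  next
    case False
    hence "laplace_kernel b a z x = 0"
      by (auto simp: laplace_kernel_def)
    thus ?thesis
      by (simp add: x_def prod_nonneg)
  qed
qed

text \<open>For fixed \<open>u\<close> the point is eventually positive and ordered; then the
  factors converge by \<open>ln_gap_limit\<close> and the divisors x_i / z_i tend to 1. Each pair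
  carries b = 2 (b / 2), matching its two occurrences in \<open>log_gas_form\<close>.\<close>

lemma laplace_kernel_limit:
  fixes z :: "real ^ 'n::{finite,linorder}"
  assumes z: "\<And>i. z $ i > 0" "strictly_increasing z"
  shows "((\<lambda>b. laplace_kernel b a z (z + sqrt (2 / b) *\<^sub>R u)) \<longlongrightarrow>
    exp (- log_gas_form a (($) z) (($) u) (($) u) / 2)) at_top"
proof -
  define x where "x b = z + sqrt (2 / b) *\<^sub>R u" for b
  define P where "P = {(i, j). i < (j :: 'n)}"
  have dz: "z $ j - z $ i > 0" if "(i, j) \<in> P" for i j
    using z(2) that by (auto simp: strictly_increasing_def P_def)
  have lim: "((\<lambda>b. x b $ i) \<longlongrightarrow> z $ i) at_top" for i
  proof -
    have "((\<lambda>b. z $ i + sqrt (2 / b) * u $ i) \<longlongrightarrow> z $ i + 0 * u $ i) at_top"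
      by (intro tendsto_intros filterlim_sqrt_two_over)
    thus ?thesis
      by (simp add: x_def)
  qed
  have "\<forall>\<^sub>F b in at_top. \<forall>i. 0 < x b $ i"
    by (intro eventually_all_finite order_tendstoD(1)[OF lim] z)
  moreover have "\<forall>\<^sub>F b in at_top. \<forall>i j. i < j \<longrightarrow> x b $ i < x b $ j"
  proof (intro eventually_all_finite)
    fix i j
    have "\<forall>\<^sub>F b in at_top. 0 < x b $ j - x b $ i" if "i < j"
      using dz[of i j] that by (intro order_tendstoD(1)[OF tendsto_diff[OF lim lim]]) (simp add: P_def)
    thus "\<forall>\<^sub>F b in at_top. i < j \<longrightarrow> x b $ i < x b $ j"
      by (cases "i < j") simp_all
  qed
  ultimately have ev: "\<forall>\<^sub>F b in at_top.
    (\<Prod>i\<in>UNIV. exp (- a * (b / 2 * ln_gap (1 + sqrt (2 / b) * (u $ i / z $ i)))) / (x b $ i / z $ i)) *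
    (\<Prod>(i, j)\<in>P. exp (- 2 * (b / 2 * ln_gap (1 + sqrt (2 / b) * ((u $ j - u $ i) / (z $ j - z $ i)))))) =
    laplace_kernel b a z (x b)"
  proof eventually_elim
    case (elim b)
    have 1: "x b $ i / z $ i = 1 + sqrt (2 / b) * (u $ i / z $ i)" for i
      using z(1)[of i] by (simp add: x_def field_simps)
    have 2: "(x b $ j - x b $ i) / (z $ j - z $ i) = 1 + sqrt (2 / b) * ((u $ j - u $ i) / (z $ j - z $ i))"
      if "(i, j) \<in> P" for i j
      using dz[OF that] by (simp add: x_def field_simps)
    have "(\<Prod>(i, j)\<in>P. exp (- 2 * (b / 2 * ln_gap (1 + sqrt (2 / b) * ((u $ j - u $ i) / (z $ j - z $ i)))))) =
      (\<Prod>(i, j)\<in>P. exp (- b * ln_gap ((x b $ j - x b $ i) / (z $ j - z $ i))))"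
      by (rule prod.cong) (auto simp: 2)
    moreover have "strictly_increasing (x b)"
      using elim by (simp add: strictly_increasing_def)
    ultimately show ?case
      using elim by (simp add: laplace_kernel_def 1 P_def mult_ac)
  qed
  have "((\<lambda>b. (\<Prod>i\<in>UNIV. exp (- a * (b / 2 * ln_gap (1 + sqrt (2 / b) * (u $ i / z $ i)))) / (x b $ i / z $ i)) *
    (\<Prod>p\<in>P. exp (- 2 * (b / 2 * ln_gap (1 + sqrt (2 / b) * ((u $ snd p - u $ fst p) / (z $ snd p - z $ fst p))))))) \<longlongrightarrow>
    (\<Prod>i\<in>UNIV. exp (- a * ((u $ i / z $ i)\<^sup>2 / 2)) / (z $ i / z $ i)) *
    (\<Prod>p\<in>P. exp (- 2 * (((u $ snd p - u $ fst p) / (z $ snd p - z $ fst p))\<^sup>2 / 2)))) at_top"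
    using z(1) by (intro tendsto_intros ln_gap_limit lim) (auto simp: less_imp_neq[symmetric])
  also have "(\<Prod>i\<in>UNIV. exp (- a * ((u $ i / z $ i)\<^sup>2 / 2)) / (z $ i / z $ i)) * 
    (\<Prod>p\<in>P. exp (- 2 * (((u $ snd p - u $ fst p) / (z $ snd p - z $ fst p))\<^sup>2 / 2))) =
    exp (- (a * (\<Sum>i\<in>UNIV. u $ i * u $ i / (z $ i)\<^sup>2) +
      2 * (\<Sum>p\<in>P. (u $ fst p - u $ snd p) * (u $ fst p - u $ snd p) / (z $ fst p - z $ snd p)\<^sup>2)) / 2)"
  proof -
    have "exp (- a * ((u $ i / z $ i)\<^sup>2 / 2)) / (z $ i / z $ i) = exp (- (a / 2) * (u $ i * u $ i / (z $ i)\<^sup>2))" for i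
      using z(1)[of i] by (simp add: power_divide power2_eq_square)
    moreover have "exp (- 2 * (((u $ snd p - u $ fst p) / (z $ snd p - z $ fst p))\<^sup>2 / 2)) =
      exp (- 1 * ((u $ fst p - u $ snd p) * (u $ fst p - u $ snd p) / (z $ fst p - z $ snd p)\<^sup>2))" for p
      by (simp add: power_divide power2_commute flip: power2_eq_square)
    ultimately show ?thesis
      by (simp only: exp_sum[symmetric] finite sum_distrib_left[symmetric] exp_add[symmetric])
         (simp add: field_simps)
  qed
  also have "2 * (\<Sum>p\<in>P. (u $ fst p - u $ snd p) * (u $ fst p - u $ snd p) / (z $ fst p - z $ snd p)\<^sup>2) =
    (\<Sum>i\<in>UNIV. \<Sum>j\<in>UNIV. (u $ i - u $ j) * (u $ i - u $ j) / (z $ i - z $ j)\<^sup>2)"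
    by (subst sum_pairs_less)
      (auto simp: P_def case_prod_unfold power2_commute simp flip: power2_eq_square)
  finally have "((\<lambda>b. (\<Prod>i\<in>UNIV. exp (- a * (b / 2 * ln_gap (1 + sqrt (2 / b) * (u $ i / z $ i)))) / (x b $ i / z $ i)) *
    (\<Prod>(i, j)\<in>P. exp (- 2 * (b / 2 * ln_gap (1 + sqrt (2 / b) * ((u $ j - u $ i) / (z $ j - z $ i))))))) \<longlongrightarrow>
    exp (- log_gas_form a (($) z) (($) u) (($) u) / 2)) at_top"
    by (simp add: log_gas_form_def case_prod_unfold)
  from Lim_transform_eventually[OF this ev] show ?thesis
    by (simp add: x_def)
qed

text \<open>Testing with the constant 1 expresses the normalisation through the integral of the
  weight, so its value (a Selberg integral) is never computed.\<close>

lemma ensemble_expectation: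
  fixes X :: "'a \<Rightarrow> real ^ 'n::{finite,linorder}"
  assumes "beta_laguerre_ensemble b a M X" and [measurable]: "g \<in> borel_measurable borel"
  shows "(LINT w|M. g (X w)) =
    (LINT x|lborel. beta_laguerre_weight b a x * g x) / (LINT x|(lborel :: (real ^ 'n::_) measure). beta_laguerre_weight b a x)"
proof -
  obtain c where M: "prob_space M" and c: "c > 0"
    and D: "distributed M lborel X (\<lambda>x. ennreal (c * beta_laguerre_weight b a x))"
    using assms(1) unfolding beta_laguerre_ensemble_def by blast
  have nonneg: "0 \<le> c * beta_laguerre_weight b a x" for x
    using c by (auto simp: beta_laguerre_weight_def intro!: mult_nonneg_nonneg prod_nonneg)
  have *: "(LINT w|M. h (X w)) = c * (LINT x|lborel. beta_laguerre_weight b a x * h x)"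
    if [measurable]: "h \<in> borel_measurable borel" for h :: "_ \<Rightarrow> real"
    using distributed_integral[OF D _ nonneg, of h] by (simp add: mult.assoc)
  have "1 = c * (LINT x|(lborel :: (real ^ 'n::_) measure). beta_laguerre_weight b a x)"
    using *[of "\<lambda>_. 1"] prob_space.prob_space[OF M] by simp
  hence "c = 1 / (LINT x|(lborel :: (real ^ 'n::_) measure). beta_laguerre_weight b a x)"
    by (metis mult_cancel_right2 mult_eq_0_iff nonzero_eq_divide_eq one_neq_zero)
  thus ?thesis
    using *[of g] by simp
qed

section \<open>Rescaling and dominated convergence\<close>

lemma integral_lborel_affine:
  fixes f :: "'a::euclidean_space \<Rightarrow> real"
  assumes [measurable]: "f \<in> borel_measurable borel" and "c > 0"
  shows "(LINT x|lborel. f x) = c ^ DIM('a) * (LINT x|lborel. f (t + c *\<^sub>R x))"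
proof -
  have "(LINT x|lborel. f x) =
    (LINT x|density (distr lborel borel (\<lambda>x. t + c *\<^sub>R x)) (\<lambda>_. ennreal (\<bar>c\<bar> ^ DIM('a))). f x)"
    using assms(2) by (subst lborel_affine[of c t]) simp_all
  also have "\<dots> = c ^ DIM('a) * (LINT x|lborel. f (t + c *\<^sub>R x))"
    using assms(2) by (subst integral_density) (auto simp: integral_distr)
  finally show ?thesis .
qed

lemma measurable_strictly_increasing [measurable]: "Measurable.pred borel (strictly_increasing :: real ^ 'n::{finite,linorder} \<Rightarrow> bool)"
  unfolding strictly_increasing_def[abs_def] by measurable

lemma measurable_laplace_kernel [measurable]:
  fixes z :: "real ^ 'n::{finite,linorder}"
  shows "laplace_kernel b a z \<in> borel_measurable borel"
proof -
  have "(\<lambda>x. ln_gap (f x)) \<in> borel_measurable borel" if [measurable]: "f \<in> borel_measurable borel"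
    for f :: "real ^ 'n::_ \<Rightarrow> real"
    unfolding ln_gap_def by measurable
  note [measurable] = this
  show ?thesis
    unfolding laplace_kernel_def[abs_def] case_prod_unfold by measurable
qed

text \<open>The constant between weight and kernel and the Jacobian of the rescaling cancel in the
  quotient.\<close>

lemma ensemble_expectation_kernel:
  fixes z :: "real ^ 'n::{finite,linorder}"
  assumes X: "beta_laguerre_ensemble b a M X" and [measurable]: "g \<in> borel_measurable borel" and "b > 0"
    and z: "\<And>i. z $ i > 0" "strictly_increasing z"
    and crit: "\<And>i. 1 = a / z $ i + 2 * (\<Sum>j\<in>UNIV. 1 / (z $ i - z $ j))"
  shows "(LINT w|M. g (X w)) =
    (LINT u|lborel. laplace_kernel b a z (z + sqrt (2 / b) *\<^sub>R u) * g (z + sqrt (2 / b) *\<^sub>R u)) /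
    (LINT u|lborel. laplace_kernel b a z (z + sqrt (2 / b) *\<^sub>R u))"
proof -
  obtain C where C: "C > 0" "\<And>x. beta_laguerre_weight b a x = C * laplace_kernel b a z x"
    using beta_laguerre_weight_eq_kernel[OF z crit] by blast
  have e: "sqrt (2 / b) > 0"
    using assms(3) by simp
  have "(LINT w|M. g (X w)) = (LINT x|lborel. laplace_kernel b a z x * g x) / (LINT x|lborel. laplace_kernel b a z x)"
    using ensemble_expectation[OF X, of g] C(1) by (simp add: C(2) mult.assoc)
  thus ?thesis
    using e by (subst (asm) (1 2) integral_lborel_affine[OF _ e, of _ z]) simp_all
qed

lemma integrable_exp_neg_abs:
  assumes "c > 0"
  shows "integrable lborel (\<lambda>x :: real. exp (- c * \<bar>x\<bar>))"
proof -
  have 1: "integrable lborel (\<lambda>x. indicator {0<..} x *\<^sub>R exp (- (x * c)))"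
    using integrable_I0i_exp_mscale[OF assms] unfolding set_integrable_def by simp
  have 2: "integrable lborel (\<lambda>x. indicator {0<..} (- x) *\<^sub>R exp (- (- x * c)))"
    using lborel_integrable_real_affine[OF 1, of "-1" 0] by simp
  \<comment> \<open>At 0 both indicators vanish, so the bound holds only almost everywhere.\<close>
  have "AE x in lborel. norm (exp (- c * \<bar>x\<bar>)) \<le>
    norm (indicator {0<..} x *\<^sub>R exp (- (x * c)) + indicator {0<..} (- x) *\<^sub>R exp (- (- x * c)))"
    using AE_lborel_singleton[of 0] by eventually_elim (auto simp: indicator_def mult.commute)
  thus ?thesis
    by (intro Bochner_Integration.integrable_bound[OF Bochner_Integration.integrable_add[OF 1 2]]) simp_all
qed

text \<open>The test function may vary with \<open>b\<close>, as the rescaled statistics do; a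
  uniform bound and pointwise convergence suffice because the kernel has a majorant independent of
  \<open>b\<close>.\<close>

lemma laplace_limit:
  fixes z :: "real ^ 'n::{finite,linorder}" and F :: "real \<Rightarrow> real ^ 'n::_ \<Rightarrow> real"
  assumes z: "\<And>i. z $ i > 0" "strictly_increasing z" and "a > 0"
    and [measurable]: "\<And>b. F b \<in> borel_measurable borel" "F' \<in> borel_measurable borel"
    and bound: "\<And>b u. \<bar>F b u\<bar> \<le> C"
    and lim: "\<And>u. ((\<lambda>b. F b u) \<longlongrightarrow> F' u) at_top"
  shows "((\<lambda>b. LINT u|lborel. laplace_kernel b a z (z + sqrt (2 / b) *\<^sub>R u) * F b u) \<longlongrightarrow>
    (LINT u|lborel. exp (- log_gas_form a (($) z) (($) u) (($) u) / 2) * F' u)) at_top"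
proof (rule integral_dominated_convergence_at_top[where
    w = "\<lambda>u. (\<Prod>i\<in>UNIV. exp (3 / 2) * exp (- (sqrt a / (4 * z $ i)) * \<bar>u $ i\<bar>)) * C"])
  show "(\<lambda>u. exp (- log_gas_form a (($) z) (($) u) (($) u) / 2) * F' u) \<in> borel_measurable lborel"
    unfolding log_gas_form_def by measurable
  show "(\<lambda>u. laplace_kernel b a z (z + sqrt (2 / b) *\<^sub>R u) * F b u) \<in> borel_measurable lborel" for b
    by measurable
  have "integrable lborel (\<lambda>x. exp (3 / 2) * exp (- (sqrt a / (4 * z $ i)) * \<bar>x\<bar>))" for i
    using z(1)[of i] assms(3) by (intro integrable_mult_right integrable_exp_neg_abs) simp
  from lborel_vec_prod(1)[of "\<lambda>i x. exp (3 / 2) * exp (- (sqrt a / (4 * z $ i)) * \<bar>x\<bar>)", OF this]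
  show "integrable lborel (\<lambda>u. (\<Prod>i\<in>UNIV. exp (3 / 2) * exp (- (sqrt a / (4 * z $ i)) * \<bar>u $ i\<bar>)) * C)"
    by (rule integrable_mult_left)
  show "AE u in lborel. ((\<lambda>b. laplace_kernel b a z (z + sqrt (2 / b) *\<^sub>R u) * F b u) \<longlongrightarrow>
    exp (- log_gas_form a (($) z) (($) u) (($) u) / 2) * F' u) at_top"
    by (intro AE_I2 tendsto_mult laplace_kernel_limit z lim)
  show "\<forall>\<^sub>F b in at_top. AE u in lborel. norm (laplace_kernel b a z (z + sqrt (2 / b) *\<^sub>R u) * F b u) \<le>
      (\<Prod>i\<in>UNIV. exp (3 / 2) * exp (- (sqrt a / (4 * z $ i)) * \<bar>u $ i\<bar>)) * C"
    \<comment> \<open>From 4 / a on, \<open>laplace_kernel_bound\<close> applies.\<close>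
    using eventually_ge_at_top[of "4 / a"] eventually_gt_at_top[of 0]
  proof eventually_elim
    case (elim b)
    hence "b / 2 * a \<ge> 2"
      using assms(3) by (simp add: field_simps)
    note kernel = laplace_kernel_bound[OF z assms(3) elim(2) this]
    show ?case
      unfolding real_norm_def abs_mult
      using kernel bound by (intro AE_I2 mult_mono) (auto simp: prod_nonneg)
  qed
qed

section \<open>The central limit theorem\<close>

theorem theorem5p8:
  fixes \<alpha> :: real
    and M :: "real \<Rightarrow> 'a measure"
    and \<Lambda> :: "real \<Rightarrow> 'a \<Rightarrow> real ^ 'n::{finite,linorder}"
    and L :: "nat \<Rightarrow> real poly"
    and z :: "real ^ 'n::{finite,linorder}"
    and q :: "nat \<Rightarrow> real poly"
    and Q :: "nat \<Rightarrow> real \<Rightarrow> real"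
  defines "N \<equiv> CARD('n)"
  assumes "N \<ge> 2" and "\<alpha> > 0"
    and "\<And>\<beta>. \<beta> > 0 \<Longrightarrow> beta_laguerre_ensemble \<beta> \<alpha> (M \<beta>) (\<Lambda> \<beta>)"
    and "monic_orthogonal_polys (laguerre_measure \<alpha>) UNIV L"
    and "strictly_increasing z" and "range (\<lambda>i. z $ i) = {x. poly (L N) x = 0}"
    and "monic_orthogonal_polys (dual_measure \<alpha> z) {..<N} q"
    and "\<And>n x. n < N \<Longrightarrow> (Q n has_real_derivative poly (q n) x) (at x)"
  shows "\<exists>G :: (real ^ 'n::{finite,linorder}) measure. centered_gaussian
            (\<chi> i j. if i = j
               then (\<alpha> + real N - 1) / real (index0 i + 1) *
                    (LINT x|dual_measure \<alpha> z. poly (q (index0 i)) x * poly (q (index0 i)) x)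
               else 0) G \<and>
          weakly_converges
            (\<lambda>\<beta>. distr (M \<beta>) borel
               (\<lambda>\<omega>. \<chi> i. sqrt (\<beta> * real N / 2) *
                  ((LINT x|empirical_measure (\<Lambda> \<beta> \<omega>). Q (index0 i) x) -
                   (LINT x|empirical_measure z. Q (index0 i) x))))
            G at_top"
proof -
  have N: "real N \<ge> 2" "N > 0"
    using \<open>N \<ge> 2\<close> by auto
  have inj_z: "inj (($) z)"
    using strictly_increasing_inj[OF \<open>strictly_increasing z\<close>] by simp
  have zero: "poly (L CARD('n)) (z $ i) = 0" for i
    using assms(7) by (auto simp: N_def)
  have z_pos: "z $ i > 0" for i
    using laguerre_zero_pos[OF \<open>\<alpha> > 0\<close> assms(5) zero] .
  have crit: "1 = \<alpha> / z $ i + 2 * (\<Sum>j\<in>UNIV. 1 / (z $ i - z $ j))" for i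
    using laguerre_zeros_critical[OF \<open>\<alpha> > 0\<close> assms(5) inj_z zero, of i]
      sum.remove[of UNIV i "\<lambda>j. 1 / (z $ i - z $ j)"] by simp
  have index0: "index0 i < N" for i :: 'n
    unfolding N_def by (rule index0_less)
  have index0_eq: "index0 i = index0 j \<longleftrightarrow> i = j" for i j :: 'n
    using inj_index0 by (auto dest: injD)
  have deg: "degree (q n) = n" "lead_coeff (q n) = 1" if "n < N" for n
    using assms(8) that unfolding monic_orthogonal_polys_def by blast+
  have int_dual: "(LINT x|dual_measure \<alpha> z. f x) = (\<Sum>i\<in>UNIV. z $ i * f (z $ i)) / (real N * (\<alpha> + real N - 1))"
    if "f \<in> borel_measurable borel" for f :: "real \<Rightarrow> real"
    unfolding dual_measure_def using that z_pos N \<open>\<alpha> > 0\<close>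
    by (subst atomic_measure_integral) (auto simp: N_def less_imp_le sum_divide_distrib)
  have measurable_poly: "poly p \<in> borel_measurable borel" for p :: "real poly"
    by (intro borel_measurable_continuous_onI continuous_intros)
  have orth: "(\<Sum>i\<in>UNIV. z $ i * poly (q n) (z $ i) * poly r (z $ i)) = 0"
    if "n < N" "\<And>k. k \<ge> n \<Longrightarrow> coeff r k = 0" for n r
  proof -
    have "(LINT x|dual_measure \<alpha> z. poly (q n) x * poly r x) = 0"
      using monic_orthogonal_polys_lower_degree[OF assms(8), of n r] that by auto
    moreover have "real N * (\<alpha> + real N - 1) \<noteq> 0"
      using N \<open>\<alpha> > 0\<close> by auto
    ultimately show ?thesis
      by (subst (asm) int_dual) (auto intro!: borel_measurable_times measurable_poly simp: mult.assoc)
  qed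
  \<comment> \<open>With n = \<open>index0 k\<close>, \<open>h k\<close> is N (\<alpha> + N - 1)
    times the squared norm of q_n under the dual measure, \<open>a k\<close> makes a column of
    \<open>g\<close> a unit vector for the form, and \<open>\<sigma> k\<close> is the claimed
    standard deviation.\<close>
  define V where "V k i = poly (q (index0 k)) (z $ i)" for k i :: 'n
  define h where "h k = (\<Sum>i\<in>UNIV. z $ i * (V k i)\<^sup>2)" for k
  define a where "a k = 1 / sqrt (real (Suc (index0 k)) * h k)" for k
  define \<sigma> where "\<sigma> k = sqrt (h k / (real (Suc (index0 k)) * real N))" for k
  have h_pos: "h k > 0" for k
  proof -
    \<comment> \<open>Otherwise q_n, of degree below N, would vanish at all N zeros.\<close>
    have "h k \<noteq> 0"
    proof
      assume "h k = 0"
      hence "\<forall>i\<in>UNIV. z $ i * (V k i)\<^sup>2 = 0"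
        unfolding h_def using z_pos by (subst (asm) sum_nonneg_eq_0_iff) (auto simp: less_imp_le)
      hence "poly (q (index0 k)) x = poly 0 x" if "x \<in> range (($) z)" for x
        using that z_pos by (auto simp: V_def less_imp_neq[symmetric])
      hence "q (index0 k) = 0"
        using index0[of k] deg(1)[OF index0[of k]] inj_z
        by (intro poly_eqI_degree[of "range (($) z)"]) (auto simp: card_image N_def)
      thus False
        using deg(2)[OF index0[of k]] by simp
    qed
    moreover have "h k \<ge> 0"
      unfolding h_def using z_pos by (intro sum_nonneg) (auto simp: less_imp_le)
    ultimately show ?thesis
      by simp
  qed
  have V_orth: "(\<Sum>i\<in>UNIV. V k i * (z $ i * V l i)) = (if k = l then h k else 0)" for k l
  proof -
    have "(\<Sum>i\<in>UNIV. z $ i * V k i * V l i) = 0" if "index0 l < index0 k" for k l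
      unfolding V_def using that deg[OF index0[of l]] by (intro orth index0 coeff_eq_0) auto
    from this[of k l] this[of l k] show ?thesis
      using index0_eq[of k l] by (cases "index0 k" "index0 l" rule: linorder_cases)
        (auto simp: h_def power2_eq_square mult_ac)
  qed
  \<comment> \<open>The directions D q_n are orthogonal for the form and, by \<open>V_orth\<close>,
    dual to the vectors \<open>V\<close> up to scaling, so they diagonalise energy and statistics
    together.\<close>
  define W where "W k i = z $ i * V k i" for k i
  have W: "log_gas_form \<alpha> (($) z) (W k) (W l) = (if k = l then real (Suc (index0 k)) * h k else 0)" for k l
  proof -
    have "log_gas_form \<alpha> (($) z) (\<lambda>i. z $ i * poly (q (index0 k)) (z $ i)) (\<lambda>i. z $ i * poly (q (index0 l)) (z $ i)) =
      (if index0 k = index0 l then real (Suc (index0 l)) * (\<Sum>i\<in>UNIV. z $ i * (poly (q (index0 l)) (z $ i))\<^sup>2) else 0)"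
      using z_pos by (intro log_gas_form_orthogonal[OF inj_z _ crit, of N q] deg orth index0) (auto simp: less_imp_neq[symmetric])
    thus ?thesis
      by (simp add: W_def[abs_def] V_def h_def index0_eq)
  qed
  define g :: "real ^ 'n::_ \<Rightarrow> real ^ 'n::_" where "g c = (\<chi> i. \<Sum>k\<in>UNIV. (a k * c $ k) * W k i)" for c
  \<comment> \<open>\<open>T\<close> is the limit of the rescaled statistics \<open>S\<close>; its
    factor is sqrt (b N / 2) * (1 / N) * sqrt (2 / b) = 1 / sqrt N.\<close>
  define T :: "real ^ 'n::_ \<Rightarrow> real ^ 'n::_" where "T u = (\<chi> k. (\<Sum>i\<in>UNIV. V k i * u $ i) / sqrt (real N))" for u
  have "linear g"
    by (simp add: g_def linear_iff vec_eq_iff distrib_left distrib_right sum.distrib sum_distrib_left mult_ac)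
  have H_g: "log_gas_form \<alpha> (($) z) (($) (g c)) (($) (g c)) = (\<Sum>k\<in>UNIV. (c $ k)\<^sup>2)" for c
  proof -
    have "($) (g c) = (\<lambda>i. \<Sum>k\<in>UNIV. (a k * c $ k) * W k i)"
      by (simp add: g_def fun_eq_iff)
    hence "log_gas_form \<alpha> (($) z) (($) (g c)) (($) (g c)) = (\<Sum>k\<in>UNIV. (a k * c $ k)\<^sup>2 * (real (Suc (index0 k)) * h k))"
      by (simp only: log_gas_form_sum[OF W])
    also have "\<dots> = (\<Sum>k\<in>UNIV. (c $ k)\<^sup>2)"
      using h_pos by (intro sum.cong) (auto simp: a_def power_mult_distrib power_divide less_imp_le less_imp_neq[symmetric])
    finally show ?thesis .
  qed
  have T_g: "T (g c) = (\<chi> k. \<sigma> k * c $ k)" for c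
  proof -
    have "(\<Sum>i\<in>UNIV. V k i * g c $ i) = a k * c $ k * h k" for k
    proof -
      have "(\<Sum>i\<in>UNIV. V k i * g c $ i) = (\<Sum>i\<in>UNIV. \<Sum>l\<in>UNIV. a l * c $ l * (V k i * (z $ i * V l i)))"
        by (simp add: g_def W_def sum_distrib_left mult_ac)
      also have "\<dots> = (\<Sum>l\<in>UNIV. a l * c $ l * (\<Sum>i\<in>UNIV. V k i * (z $ i * V l i)))"
        by (subst sum.swap) (simp add: sum_distrib_left)
      also have "\<dots> = a k * c $ k * h k"
        by (simp add: V_orth if_distrib cong: if_cong)
      finally show ?thesis .
    qed
    moreover have "a k * h k / sqrt (real N) = \<sigma> k" for k
    proof -
      have "a k * h k / sqrt (real N) =
        sqrt (h k) * sqrt (h k) / (sqrt (real (Suc (index0 k))) * sqrt (h k)) / sqrt (real N)"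
        using h_pos[of k] by (simp add: a_def less_imp_le flip: real_sqrt_mult)
      also have "\<dots> = sqrt (h k) / (sqrt (real (Suc (index0 k))) * sqrt (real N))"
      proof -
        have "x * x / (s * x) / n = x / (s * n)" if "x \<noteq> 0" for x s n :: real
          using that by simp
        thus ?thesis
          using h_pos[of k] by (metis less_irrefl real_sqrt_gt_zero)
      qed
      also have "\<dots> = \<sigma> k"
        by (simp only: \<sigma>_def real_sqrt_divide real_sqrt_mult)
      finally show ?thesis .
    qed
    hence "a k * c $ k * h k / sqrt (real N) = \<sigma> k * c $ k" for k
      by (metis mult.commute mult.left_commute times_divide_eq_right)
    ultimately show ?thesis
      by (simp add: T_def)
  qed
  define S :: "real \<Rightarrow> real ^ 'n::_ \<Rightarrow> real ^ 'n::_" where "S b x = (\<chi> k. sqrt (b * real N / 2) *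
      ((\<Sum>i\<in>UNIV. Q (index0 k) (x $ i)) / real N - (\<Sum>i\<in>UNIV. Q (index0 k) (z $ i)) / real N))"
    for b x
  have cont_Q: "continuous_on UNIV (Q (index0 k))" for k :: 'n
    using assms(9)[OF index0] by (meson DERIV_isCont continuous_at_imp_continuous_on)
  have [measurable]: "Q (index0 k) \<in> borel_measurable borel" for k :: 'n
    by (rule borel_measurable_continuous_onI[OF cont_Q])
  have cont_S: "continuous_on UNIV (S b)" for b
  proof -
    have "continuous_on UNIV (\<lambda>x :: real ^ 'n::_. Q (index0 k) (x $ i))" for k i :: 'n
      by (rule continuous_on_compose2[OF cont_Q]) (auto intro!: continuous_intros)
    thus ?thesis
      unfolding S_def using N by (intro continuous_intros continuous_on_vec_lambda) auto
  qed
  have [measurable]: "S b \<in> borel_measurable borel" for b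
    by (rule borel_measurable_continuous_onI[OF cont_S])
  have [measurable]: "T \<in> borel_measurable borel"
    unfolding T_def using N
    by (intro borel_measurable_continuous_onI continuous_intros continuous_on_vec_lambda) auto
  have int_emp: "(LINT x|empirical_measure y. Q (index0 k) x) = (\<Sum>i\<in>UNIV. Q (index0 k) (y $ i)) / real N"
    for y :: "real ^ 'n::_" and k :: 'n
    unfolding empirical_measure_def N_def by (subst atomic_measure_integral) (simp_all add: sum_divide_distrib)
  \<comment> \<open>With step sqrt (2 / b) every summand is a difference quotient of Q_n at a
    zero.\<close>
  have S_lim: "((\<lambda>b. S b (z + sqrt (2 / b) *\<^sub>R u)) \<longlongrightarrow> T u) at_top" for u
  proof (rule vec_tendstoI)
    fix k :: 'n
    have lim: "((\<lambda>b. (Q (index0 k) (z $ i + sqrt (2 / b) * u $ i) - Q (index0 k) (z $ i)) / sqrt (2 / b)) \<longlongrightarrow> V k i * u $ i) at_top" for i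
    proof -
      have 0: "(Q (index0 k) has_real_derivative V k i) (at (z $ i + 0 * u $ i))"
        using assms(9)[OF index0, of k "z $ i"] by (simp add: V_def)
      have "((\<lambda>t. Q (index0 k) (z $ i + t * u $ i)) has_real_derivative V k i * u $ i) (at 0)"
        by (rule DERIV_chain2[where f = "Q (index0 k)" and g = "\<lambda>t. z $ i + t * u $ i", OF 0])
           (auto intro!: derivative_eq_intros)
      hence "((\<lambda>t. (Q (index0 k) (z $ i + t * u $ i) - Q (index0 k) (z $ i)) / t) \<longlongrightarrow> V k i * u $ i) (at 0)"
        by (simp add: has_field_derivative_iff)
      moreover have "filterlim (\<lambda>b. sqrt (2 / b)) (at 0) at_top"
        unfolding filterlim_at using filterlim_sqrt_two_over eventually_gt_at_top[of 0]
        by (auto elim: eventually_mono)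
      ultimately show ?thesis
        by (rule filterlim_compose)
    qed
    have "((\<lambda>b. (\<Sum>i\<in>UNIV. (Q (index0 k) (z $ i + sqrt (2 / b) * u $ i) - Q (index0 k) (z $ i)) / sqrt (2 / b)) / sqrt (real N))
      \<longlongrightarrow> T u $ k) at_top"
      unfolding T_def vec_lambda_beta using N by (intro tendsto_intros lim) auto
    moreover have "\<forall>\<^sub>F b in at_top. (\<Sum>i\<in>UNIV. (Q (index0 k) (z $ i + sqrt (2 / b) * u $ i) - Q (index0 k) (z $ i)) / sqrt (2 / b)) / sqrt (real N) =
      S b (z + sqrt (2 / b) *\<^sub>R u) $ k"
      using eventually_gt_at_top[of 0]
    proof eventually_elim
      case (elim b)
      have "sqrt (b * real N / 2) = sqrt (real N) / sqrt (2 / b)"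
        using elim by (simp add: real_sqrt_mult real_sqrt_divide)
      also have "\<dots> / real N = (sqrt (real N) / real N) / sqrt (2 / b)"
        by simp
      also have "\<dots> = 1 / (sqrt (2 / b) * sqrt (real N))"
        by (simp add: sqrt_divide_self_eq inverse_eq_divide)
      finally have factor: "sqrt (b * real N / 2) / real N = 1 / (sqrt (2 / b) * sqrt (real N))" .
      have "S b (z + sqrt (2 / b) *\<^sub>R u) $ k =
        (\<Sum>i\<in>UNIV. Q (index0 k) (z $ i + sqrt (2 / b) * u $ i) - Q (index0 k) (z $ i)) * (sqrt (b * real N / 2) / real N)"
        by (simp add: S_def sum_subtractf diff_divide_distrib[symmetric])
      thus ?case
        unfolding factor
        by (simp add: sum_divide_distrib[symmetric])
    qed
    ultimately show "((\<lambda>b. S b (z + sqrt (2 / b) *\<^sub>R u) $ k) \<longlongrightarrow> T u $ k) at_top"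
      by (rule Lim_transform_eventually)
  qed
  have "(\<lambda>u :: real ^ 'n::_. log_gas_form \<alpha> (($) z) (($) u) (($) u)) \<in> borel_measurable borel"
    unfolding log_gas_form_def by measurable
  then obtain K where K: "K > 0" "\<And>f :: real ^ 'n::_ \<Rightarrow> real. f \<in> borel_measurable borel \<Longrightarrow>
    (LINT u|lborel. exp (- log_gas_form \<alpha> (($) z) (($) u) (($) u) / 2) * f (T u)) = K * (LINT x|diagonal_gaussian \<sigma>. f x)"
    using integral_quadratic_form_gaussian[OF \<open>linear g\<close> \<open>T \<in> borel_measurable borel\<close> _ H_g T_g] by blast
  \<comment> \<open>The constant test function gives the limit of the denominators, so
    \<open>K\<close> cancels.\<close>
  have K_one: "(LINT u|lborel. exp (- log_gas_form \<alpha> (($) z) (($) (u :: real ^ 'n::_)) (($) u) / 2) * 1) = K"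
    using K(2)[of "\<lambda>_. 1"] prob_space.prob_space[OF prob_space_diagonal_gaussian, of \<sigma>] by simp
  have weak: "weakly_converges (\<lambda>b. distr (M b) borel (\<lambda>\<omega>. S b (\<Lambda> b \<omega>))) (diagonal_gaussian \<sigma>) at_top"
    unfolding weakly_converges_def
  proof (intro allI impI)
    fix f :: "real ^ 'n::_ \<Rightarrow> real"
    assume f: "continuous_on UNIV f" "bounded (range f)"
    have [measurable]: "f \<in> borel_measurable borel"
      by (rule borel_measurable_continuous_onI[OF f(1)])
    obtain C where C: "\<And>x. \<bar>f x\<bar> \<le> C"
      using f(2) by (auto simp: bounded_iff)
    define J where "J F b = (LINT u|lborel. laplace_kernel b \<alpha> z (z + sqrt (2 / b) *\<^sub>R u) * F (S b (z + sqrt (2 / b) *\<^sub>R u)))"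
      for F :: "real ^ 'n::_ \<Rightarrow> real" and b
    have "isCont f x" for x
      using f(1) by (simp add: continuous_on_eq_continuous_at)
    hence "(J f \<longlongrightarrow> K * (LINT x|diagonal_gaussian \<sigma>. f x)) at_top"
      unfolding J_def K(2)[OF \<open>f \<in> borel_measurable borel\<close>, symmetric]
      by (intro laplace_limit[where C = C] z_pos assms(3,6) C isCont_tendsto_compose[OF _ S_lim]) simp_all
    moreover have "(J (\<lambda>_. 1) \<longlongrightarrow> K) at_top"
      unfolding J_def K_one[symmetric]
      by (intro laplace_limit[where C = 1] z_pos assms(3,6)) simp_all
    ultimately have "((\<lambda>b. J f b / J (\<lambda>_. 1) b) \<longlongrightarrow> K * (LINT x|diagonal_gaussian \<sigma>. f x) / K) at_top"
      using K(1) by (intro tendsto_divide) auto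
    hence "((\<lambda>b. J f b / J (\<lambda>_. 1) b) \<longlongrightarrow> (LINT x|diagonal_gaussian \<sigma>. f x)) at_top"
      using K(1) by simp
    \<comment> \<open>Only eventual equality, since the ensemble is specified for positive
      \<open>b\<close>.\<close>
    moreover have "\<forall>\<^sub>F b in at_top. J f b / J (\<lambda>_. 1) b = (LINT x|distr (M b) borel (\<lambda>\<omega>. S b (\<Lambda> b \<omega>)). f x)"
      using eventually_gt_at_top[of 0]
    proof eventually_elim
      case (elim b)
      have "\<Lambda> b \<in> M b \<rightarrow>\<^sub>M lborel"
        using assms(4)[OF elim] unfolding beta_laguerre_ensemble_def by (auto dest: distributed_measurable)
      hence [measurable]: "\<Lambda> b \<in> M b \<rightarrow>\<^sub>M borel"
        by simp
      have "(LINT x|distr (M b) borel (\<lambda>\<omega>. S b (\<Lambda> b \<omega>)). f x) = (LINT \<omega>|M b. f (S b (\<Lambda> b \<omega>)))"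
        by (rule integral_distr) simp_all
      also have "\<dots> = J f b / J (\<lambda>_. 1) b"
        unfolding J_def
        by (subst ensemble_expectation_kernel[OF assms(4)[OF elim] _ elim z_pos assms(6) crit, of "\<lambda>x. f (S b x)"]) simp_all
      finally show ?case
        by simp
    qed
    ultimately show "((\<lambda>b. LINT x|distr (M b) borel (\<lambda>\<omega>. S b (\<Lambda> b \<omega>)). f x) \<longlongrightarrow> (LINT x|diagonal_gaussian \<sigma>. f x)) at_top"
      by (rule Lim_transform_eventually)
  qed
  have variance: "(\<sigma> i)\<^sup>2 = (\<alpha> + real N - 1) / real (index0 i + 1) *
    (LINT x|dual_measure \<alpha> z. poly (q (index0 i)) x * poly (q (index0 i)) x)" for i
  proof -
    have "\<alpha> + real N - 1 \<noteq> 0"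
      using N \<open>\<alpha> > 0\<close> by auto
    moreover have "(LINT x|dual_measure \<alpha> z. poly (q (index0 i)) x * poly (q (index0 i)) x) = h i / (real N * (\<alpha> + real N - 1))"
      by (subst int_dual) (auto intro!: borel_measurable_times measurable_poly simp: h_def V_def power2_eq_square)
    ultimately show ?thesis
      using h_pos[of i] by (simp add: \<sigma>_def less_imp_le)
  qed
  show ?thesis
    unfolding int_emp using centered_gaussian_diagonal_gaussian[of \<sigma>, unfolded variance] weak[unfolded S_def]
    by (intro exI[of _ "diagonal_gaussian \<sigma>"] conjI)
qed

end
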